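(* Let $\alpha,\beta,\gamma,\delta,\kappa$ be positive integers satisfying $0<\delta+\gamma\le\beta+\kappa$ and $\kappa\le\min(\alpha,\gamma)$. Then there is a $\mathbb{Z}_5\mathbb{Z}_{25}$-linear code $C$ of type $(\alpha,\beta;\gamma,\delta;\kappa)$ with $rank(C)=r$ if and only if $$r\in\left\{\gamma+2\delta,\ldots,\min\left(\beta+\delta+\kappa,\ \gamma+\delta+\binom{\delta+2}{3}+\binom{\delta+3}{4}+\binom{\delta+4}{5}\right)\right\}.$$
   Context: A $\mathbb{Z}_5\mathbb{Z}_{25}$-additive code is a subgroup $\mathcal{C}$ of $\mathbb{Z}_5^\alpha\times\mathbb{Z}_{25}^\beta$. The Gray map $\phi:\mathbb{Z}_{25}\to\mathbb{Z}_5^5$ is $\phi(u)=(u_1,u_1,u_1,u_1,u_1)+u_0\,Y$, where $u=u_0+5u_1$ with $u_0,u_1\in\{0,\ldots,4\}$ and $Y$ is a fixed row vector listing all distinct elements of $\mathbb{Z}_5$, e.g. $Y=(0,1,2,3,4)$. Its extension $\Phi:\mathbb{Z}_5^\alpha\times\mathbb{Z}_{25}^\beta\to\mathbb{Z}_5^{n}$, $n=\alpha+5\beta$, is $\Phi(\mathbf{x},\mathbf{y})=(\mathbf{x},\phi(y_1),\ldots,\phi(y_\beta))$. A code is called $\mathbb{Z}_5\mathbb{Z}_{25}$-linear if it equals $\Phi(\mathcal{C})$ for some $\mathbb{Z}_5\mathbb{Z}_{25}$-additive code $\mathcal{C}$. The additive code $\mathcal{C}$ (and $C=\Phi(\mathcal{C})$)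 is of type $(\alpha,\beta;\gamma,\delta;\kappa)$ if $\mathcal{C}\subseteq\mathbb{Z}_5^\alpha\times\mathbb{Z}_{25}^\beta$, $\mathcal{C}\cong\mathbb{Z}_5^\gamma\times\mathbb{Z}_{25}^\delta$ as a group, and $\kappa$ is the dimension over $\mathbb{Z}_5$ of the projection onto the first $\alpha$ (i.e. the $\mathbb{Z}_5$-) coordinates of the subcode $\{\mathbf{c}\in\mathcal{C}: 5\mathbf{c}=\mathbf{0}\}$ ($\kappa=0$ if $\alpha=0$). $\langle C\rangle$ is the $\mathbb{Z}_5$-linear span of $C$, and $rank(C)=\dim\langle C\rangle$. The notation $\{a,\ldots,b\}$ denotes the set of integers $x$ with $a\le x\le b$. *)

theory Defs
  imports
    "HOL-Library.Function_Algebras"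
    "HOL-Algebra.Product_Groups"
    "Berlekamp_Zassenhaus.Finite_Field"
begin

text \<open>
  \<open>finite_5\<close> serves only as an index type: \<open>mod_ring\<close> is the ring of integers modulo
  the cardinality of its argument, hence here the field with five elements.
\<close>

lemma card_finite_5: "CARD(Enum.finite_5) = 5"
  by (simp add: UNIV_finite_5)

instance Enum.finite_5 :: prime_card
  by standard (simp add: card_finite_5)

type_synonym gf5 = "Enum.finite_5 mod_ring"

text \<open>
  Words over \<open>gf5\<close> of any length \<open>n\<close> are functions \<open>nat \<Rightarrow> gf5\<close> vanishing outside
  \<open>{..<n}\<close>, so that they all live in one vector space.
\<close>

definition scale_word :: "gf5 \<Rightarrow> (nat \<Rightarrow> gf5) \<Rightarrow> nat \<Rightarrow> gf5" where
  "scale_word c v = (\<lambda>i. c * v i)"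

interpretation word_space: vector_space scale_word
  by standard (auto simp: scale_word_def plus_fun_def fun_eq_iff algebra_simps)

definition rank :: "(nat \<Rightarrow> gf5) set \<Rightarrow> nat" where
  "rank C = word_space.dim (word_space.span C)"

text \<open>The group \<open>\<int>\<^sub>5\<^sup>a \<times> \<int>\<^sub>2\<^sub>5\<^sup>b\<close>; residues are represented in \<open>{0..<5}\<close> and \<open>{0..<25}\<close>.\<close>

definition mixed_group :: "nat \<Rightarrow> nat \<Rightarrow> ((nat \<Rightarrow> int) \<times> (nat \<Rightarrow> int)) monoid" where
  "mixed_group a b =
     product_group {..<a} (\<lambda>_. integer_mod_group 5) \<times>\<times>
     product_group {..<b} (\<lambda>_. integer_mod_group 25)"

definition first_coords :: "nat \<Rightarrow> (nat \<Rightarrow> int) \<times> (nat \<Rightarrow> int) \<Rightarrow> nat \<Rightarrow> gf5" where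
  "first_coords \<alpha> = (\<lambda>(x, y) i. if i < \<alpha> then of_int (x i) else 0)"

definition order5_subcode ::
  "nat \<Rightarrow> nat \<Rightarrow> ((nat \<Rightarrow> int) \<times> (nat \<Rightarrow> int)) set \<Rightarrow> ((nat \<Rightarrow> int) \<times> (nat \<Rightarrow> int)) set" where
  "order5_subcode \<alpha> \<beta> \<C> =
     {c \<in> \<C>. c [^]\<^bsub>mixed_group \<alpha> \<beta>\<^esub> (5::nat) = \<one>\<^bsub>mixed_group \<alpha> \<beta>\<^esub>}"

definition additive_code_of_type ::
  "nat \<Rightarrow> nat \<Rightarrow> nat \<Rightarrow> nat \<Rightarrow> nat \<Rightarrow> ((nat \<Rightarrow> int) \<times> (nat \<Rightarrow> int)) set \<Rightarrow> bool" where
  "additive_code_of_type \<alpha> \<beta> \<gamma> \<delta> \<kappa> \<C> \<longleftrightarrow>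
     subgroup \<C> (mixed_group \<alpha> \<beta>) \<and>
     (mixed_group \<alpha> \<beta>)\<lparr>carrier := \<C>\<rparr> \<cong> mixed_group \<gamma> \<delta> \<and>
     word_space.dim (first_coords \<alpha> ` order5_subcode \<alpha> \<beta> \<C>) = \<kappa>"

text \<open>For \<open>0 \<le> u < 25\<close>, \<open>u mod 5\<close> and \<open>u div 5\<close> are the base-5 digits of \<open>u\<close>.\<close>

definition gray :: "(nat \<Rightarrow> gf5) \<Rightarrow> int \<Rightarrow> nat \<Rightarrow> gf5" where
  "gray Y u k = of_int (u div 5) + of_int (u mod 5) * Y k"

definition Gray ::
  "(nat \<Rightarrow> gf5) \<Rightarrow> nat \<Rightarrow> nat \<Rightarrow> (nat \<Rightarrow> int) \<times> (nat \<Rightarrow> int) \<Rightarrow> nat \<Rightarrow> gf5" where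
  "Gray Y \<alpha> \<beta> = (\<lambda>(x, y) i.
     if i < \<alpha> then of_int (x i)
     else if i < \<alpha> + 5 * \<beta> then gray Y (y ((i - \<alpha>) div 5)) ((i - \<alpha>) mod 5)
     else 0)"

definition linear_code_of_type ::
  "(nat \<Rightarrow> gf5) \<Rightarrow> nat \<Rightarrow> nat \<Rightarrow> nat \<Rightarrow> nat \<Rightarrow> nat \<Rightarrow> (nat \<Rightarrow> gf5) set \<Rightarrow> bool" where
  "linear_code_of_type Y \<alpha> \<beta> \<gamma> \<delta> \<kappa> C \<longleftrightarrow>
     (\<exists>\<C>. additive_code_of_type \<alpha> \<beta> \<gamma> \<delta> \<kappa> \<C> \<and> C = Gray Y \<alpha> \<beta> ` \<C>)"

end

theory Submission
  imports Defs
begin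

text \<open>
  Since row rank equals column rank, the rank of \<open>Gray Y \<alpha> \<beta> ` \<C>\<close> is the dimension of the space
  spanned by the coordinate functions on \<open>\<C>\<close>. Write a codeword with coefficients \<open>z\<close> over \<open>gf5\<close>,
  splitting each coefficient \<open>a + 5 * b\<close> at a generator of order 25 into its digits \<open>a\<close> and \<open>b\<close>.
  All coordinate functions are then linear in \<open>z\<close>, except for the high digits of the \<open>\<int>\<^sub>2\<^sub>5\<close>
  coordinates: these contain quotients \<open>(\<Sum>t. p t * a t) div 5\<close>. The carry of two base-5 digits is
  a polynomial whose terms have degree 3, 4 or 5 only, so every quotient is a combination of
  monomials in the \<open>a t\<close> of these degrees, which gives the binomial bound. The bound
  \<open>\<beta> + \<delta> + \<kappa>\<close> comes from the fact that the high digits alone span at most \<open>\<beta>\<close> dimensions, and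
  the lower bound from counting codewords.

  Conversely, scaling and polarizing the carry polynomial shows that the quotients span all
  monomials of degree 3, 4 and 5. One can therefore choose any admissible number of quotients that
  are independent modulo the linear functions, and use each as one additional \<open>\<int>\<^sub>2\<^sub>5\<close> coordinate.
\<close>

subsection \<open>Carries over the field with five elements\<close>

definition lift5 :: "gf5 \<Rightarrow> int" where
  "lift5 = to_int_mod_ring"

lemma lift5_nonneg [simp]: "0 \<le> lift5 x" and lift5_less [simp]: "lift5 x < 5"
  using range_to_int_mod_ring[where 'a = Enum.finite_5]
  by (auto simp: lift5_def card_finite_5 set_eq_iff)

lemma of_int_lift5 [simp]: "of_int (lift5 x) = x"
  by (simp add: lift5_def of_int_of_int_mod_ring)

lemma lift5_of_int [simp]: "lift5 (of_int n) = n mod 5"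
  unfolding lift5_def of_int_of_int_mod_ring
  by transfer (simp add: card_finite_5)

lemma of_int_gf5_eq_iff: "(of_int m :: gf5) = of_int n \<longleftrightarrow> m mod 5 = n mod 5"
  by (metis lift5_of_int of_int_lift5)

lemma of_int_mod_5 [simp]: "(of_int (m mod 5) :: gf5) = of_int m"
  by (simp add: of_int_gf5_eq_iff)

lemma of_int_gf5_cong: "[m = n] (mod 5) \<Longrightarrow> (of_int m :: gf5) = of_int n"
  by (simp add: of_int_gf5_eq_iff cong_def)

lemma five_gf5 [simp]: "(5 :: gf5) = 0"
  using of_int_gf5_eq_iff[of 5 0] by simp

lemma numeral_gf5_eq_iff:
  "(numeral a :: gf5) = numeral b \<longleftrightarrow> (numeral a :: int) mod 5 = numeral b mod 5"
  "(numeral a :: gf5) = 0 \<longleftrightarrow> (numeral a :: int) mod 5 = 0"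
  "(numeral a :: gf5) = 1 \<longleftrightarrow> (numeral a :: int) mod 5 = 1"
  "0 = (numeral a :: gf5) \<longleftrightarrow> (numeral a :: int) mod 5 = 0"
  "1 = (numeral a :: gf5) \<longleftrightarrow> (numeral a :: int) mod 5 = 1"
  using of_int_gf5_eq_iff[of "numeral a" "numeral b"] of_int_gf5_eq_iff[of "numeral a" 0]
    of_int_gf5_eq_iff[of "numeral a" 1] of_int_gf5_eq_iff[of 0 "numeral a"]
    of_int_gf5_eq_iff[of 1 "numeral a"]
  by auto

lemma gf5_cases: "x \<in> {0, 1, 2, 3, 4 :: gf5}"
proof -
  have "lift5 x \<in> {0, 1, 2, 3, 4}"
    using lift5_nonneg[of x] lift5_less[of x] by (simp, linarith)
  then show ?thesis
    by (metis (no_types, lifting) insert_iff of_int_lift5 of_int_0 of_int_1 of_int_numeral empty_iff)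
qed

lemma UNIV_gf5: "(UNIV :: gf5 set) = {0, 1, 2, 3, 4}"
  using gf5_cases by auto

lemma all_gf5: "(\<forall>x :: gf5. P x) \<longleftrightarrow> P 0 \<and> P 1 \<and> P 2 \<and> P 3 \<and> P 4"
  using gf5_cases by (metis empty_iff insert_iff)

lemma sum_gf5: "(\<Sum>x\<in>(UNIV :: gf5 set). f x) = f 0 + f 1 + f 2 + f 3 + (f 4 :: gf5)"
  by (simp add: UNIV_gf5 numeral_gf5_eq_iff add.assoc)

lemma lift5_numeral [simp]: "lift5 0 = 0" "lift5 1 = 1" "lift5 (numeral n) = numeral n mod 5"
  using lift5_of_int[of 0] lift5_of_int[of 1] lift5_of_int[of "numeral n"] by simp_all

section \<open>The carry of two base-5 digits as a polynomial\<close>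

definition carry5 :: "gf5 \<Rightarrow> gf5 \<Rightarrow> gf5" where
  "carry5 s t = of_int ((lift5 s + lift5 t) div 5)"

text \<open>The degree 5 part is \<open>(s^5 + t^5 - (s + t)^5) / 5\<close>, the carry of Witt
  vectors of length two. The rest accounts for digits in place of Teichmueller representatives: it
  is \<open>w (s + t) - w s - w t\<close> for \<open>w x = 2 * x^4 + 3 * x^3\<close>. The identity
  is checked on all 25 pairs.\<close>

lemma carry5_poly:
  "carry5 s t = - (s^4 * t + 2 * s^3 * t^2 + 2 * s^2 * t^3 + s * t^4)
     + (3 * s^3 * t + 2 * s^2 * t^2 + 3 * s * t^3) + (4 * s^2 * t + 4 * s * t^2)"
proof -
  have "\<forall>s t. carry5 s t = - (s^4 * t + 2 * s^3 * t^2 + 2 * s^2 * t^3 + s * t^4)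
     + (3 * s^3 * t + 2 * s^2 * t^2 + 3 * s * t^3) + (4 * s^2 * t + 4 * s * t^2)"
    by (simp only: all_gf5 carry5_def) (simp add: numeral_gf5_eq_iff)
  then show ?thesis by blast
qed

text \<open>The sum of \<open>k^n\<close> over the field is -1 if \<open>n\<close> is a positive
  multiple of 4 and 0 otherwise. Hence the weighted sums over \<open>k\<close> and \<open>j\<close>
  isolate single powers of \<open>s\<close> and \<open>t\<close> in \<open>carry5_poly\<close>; in
  the second identity the combination of \<open>2 * t\<close> and \<open>t\<close> cancels
  \<open>s^3 * t^2\<close>.\<close>

lemma carry5_extract:
  "s^4 * t = (\<Sum>k\<in>UNIV. carry5 (k * s) t)"
  "s^3 * t = (\<Sum>k\<in>UNIV. k * (carry5 (k * s) (2 * t) + carry5 (k * s) t))"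
  "s^2 * t = (\<Sum>k\<in>UNIV. \<Sum>j\<in>UNIV. 4 * k^2 * j^3 * carry5 (k * s) (j * t))"
proof -
  have "\<forall>s t. s^4 * t = (\<Sum>k\<in>UNIV. carry5 (k * s) t)"
    by (simp only: all_gf5 carry5_def sum_gf5) (simp add: numeral_gf5_eq_iff)
  moreover have "\<forall>s t. s^3 * t = (\<Sum>k\<in>UNIV. k * (carry5 (k * s) (2 * t) + carry5 (k * s) t))"
    by (simp only: all_gf5 carry5_def sum_gf5) (simp add: numeral_gf5_eq_iff)
  moreover have "\<forall>s t. s^2 * t = (\<Sum>k\<in>UNIV. \<Sum>j\<in>UNIV. 4 * k^2 * j^3 * carry5 (k * s) (j * t))"
    by (simp only: all_gf5 carry5_def sum_gf5) (simp add: numeral_gf5_eq_iff)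
  ultimately show "s^4 * t = (\<Sum>k\<in>UNIV. carry5 (k * s) t)"
    "s^3 * t = (\<Sum>k\<in>UNIV. k * (carry5 (k * s) (2 * t) + carry5 (k * s) t))"
    "s^2 * t = (\<Sum>k\<in>UNIV. \<Sum>j\<in>UNIV. 4 * k^2 * j^3 * carry5 (k * s) (j * t))" by blast+
qed

text \<open>By the same power sums, the weight \<open>k^3\<close> isolates the part that is linear
  in \<open>t\<close>; the scalars normalize its coefficient.\<close>

lemma polarize5:
  "s * t = (\<Sum>k\<in>UNIV. 2 * k^3 * (s + k * t)^2)"
  "s^2 * t = (\<Sum>k\<in>UNIV. 3 * k^3 * (s + k * t)^3)"
  "s^3 * t = (\<Sum>k\<in>UNIV. k^3 * (s + k * t)^4)" for s t :: gf5
proof -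
  have "\<forall>s t :: gf5. s * t = (\<Sum>k\<in>UNIV. 2 * k^3 * (s + k * t)^2)"
    by (simp only: all_gf5 sum_gf5) (simp add: numeral_gf5_eq_iff)
  moreover have "\<forall>s t :: gf5. s^2 * t = (\<Sum>k\<in>UNIV. 3 * k^3 * (s + k * t)^3)"
    by (simp only: all_gf5 sum_gf5) (simp add: numeral_gf5_eq_iff)
  moreover have "\<forall>s t :: gf5. s^3 * t = (\<Sum>k\<in>UNIV. k^3 * (s + k * t)^4)"
    by (simp only: all_gf5 sum_gf5) (simp add: numeral_gf5_eq_iff)
  ultimately show "s * t = (\<Sum>k\<in>UNIV. 2 * k^3 * (s + k * t)^2)"
    "s^2 * t = (\<Sum>k\<in>UNIV. 3 * k^3 * (s + k * t)^3)"
    "s^3 * t = (\<Sum>k\<in>UNIV. k^3 * (s + k * t)^4)" by blast+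
qed

lemma gf5_pow_5 [simp]: "(x :: gf5)^5 = x"
proof -
  have "\<forall>x :: gf5. x^5 = x" by (simp only: all_gf5) (simp add: numeral_gf5_eq_iff)
  then show ?thesis by blast
qed

text \<open>Dual to the powers \<open>x ^ 0, \<dots>, x ^ 4\<close> under the pairing \<open>\<Sum>x. f x * g x\<close>.\<close>

definition dual_power :: "nat \<Rightarrow> gf5 \<Rightarrow> gf5" where
  "dual_power e x = (if e = 0 then 1 - x^4 else - (x^(4 - e)))"

lemma sum_dual_power:
  assumes "e \<le> 4" "f \<le> 4"
  shows "(\<Sum>x\<in>UNIV. x^f * dual_power e x) = (if e = f then 1 else 0)"
proof -
  have "e \<in> {0,1,2,3,4}" "f \<in> {0,1,2,3,4}" using assms by auto
  then show ?thesis
    by (elim insertE emptyE; simp add: sum_gf5 dual_power_def numeral_gf5_eq_iff)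
qed

subsection \<open>Spaces of functions and monomials\<close>

text \<open>Generalizes \<open>scale_word\<close> to any domain, so that words and functions of the
  coefficient vector \<open>z\<close> share one theory of spans.\<close>

definition scale_fun :: "gf5 \<Rightarrow> ('a \<Rightarrow> gf5) \<Rightarrow> 'a \<Rightarrow> gf5" where
  "scale_fun c f = (\<lambda>x. c * f x)"

interpretation fun_space: vector_space scale_fun
  by standard (auto simp: scale_fun_def plus_fun_def fun_eq_iff algebra_simps)

lemma scale_word_eq_scale_fun: "scale_word = scale_fun"
  by (simp add: scale_word_def scale_fun_def fun_eq_iff)

lemma scale_fun_apply: "scale_fun c f x = c * f x"
  by (simp add: scale_fun_def)

lemma sum_fun_apply: "(\<Sum>i\<in>A. f i) x = (\<Sum>i\<in>A. f i x)" for f :: "'i \<Rightarrow> 'a \<Rightarrow> gf5"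
  by (induction A rule: infinite_finite_induct) (auto simp: zero_fun_def plus_fun_def)

lemma span_plus: "f \<in> fun_space.span S \<Longrightarrow> g \<in> fun_space.span S \<Longrightarrow> (\<lambda>z. f z + g z) \<in> fun_space.span S"
  using fun_space.span_add[of f S g] by (simp add: plus_fun_def)

lemma span_times: "f \<in> fun_space.span S \<Longrightarrow> (\<lambda>z. c * f z) \<in> fun_space.span S"
  using fun_space.span_scale[of f S c] by (simp add: scale_fun_def)

lemma span_zero_fun: "(\<lambda>z. 0) \<in> fun_space.span S"
  using fun_space.span_zero[of S] by (simp add: zero_fun_def)

lemma span_minus: "f \<in> fun_space.span S \<Longrightarrow> g \<in> fun_space.span S \<Longrightarrow> (\<lambda>z. f z - g z) \<in> fun_space.span S"
  using span_plus[OF _ span_times[of g S "-1"], of f] by simp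

lemma span_sum_fun:
  assumes "\<And>i. i \<in> A \<Longrightarrow> f i \<in> fun_space.span S"
  shows "(\<lambda>z. \<Sum>i\<in>A. f i z) \<in> fun_space.span S"
  using assms
  by (induction A rule: infinite_finite_induct) (auto intro: span_plus span_zero_fun)

text \<open>Writing every row in terms of \<open>B\<close> factors \<open>F\<close> as a matrix
  product; the coefficient functions \<open>u _ v\<close> then span all columns. It serves to pass
  between words and coordinate functions in both directions.\<close>

lemma column_span_of_row_span:
  fixes F :: "'a \<Rightarrow> 'b \<Rightarrow> gf5"
  assumes "\<And>a. F a \<in> fun_space.span B" "finite B"
  obtains M where "finite M" "card M \<le> card B" "\<And>b. (\<lambda>a. F a b) \<in> fun_space.span M"
proof -
  have "\<exists>u. F a = (\<Sum>v\<in>B. scale_fun (u v) v)" for a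
    using assms(1)[of a] by (auto simp: fun_space.span_finite[OF assms(2)])
  then obtain u where u: "\<And>a. F a = (\<Sum>v\<in>B. scale_fun (u a v) v)"
    by metis
  define M where "M = (\<lambda>v a. u a v) ` B"
  have "(\<lambda>a. F a b) \<in> fun_space.span M" for b
  proof -
    have "(\<lambda>a. F a b) = (\<lambda>a. \<Sum>v\<in>B. v b * u a v)"
      by (subst u) (simp add: sum_fun_apply scale_fun_apply mult.commute)
    also have "\<dots> \<in> fun_space.span M"
      by (intro span_sum_fun span_times fun_space.span_base) (auto simp: M_def)
    finally show ?thesis .
  qed
  with that[of M] show thesis
    using assms(2) card_image_le by (auto simp: M_def)
qed

section \<open>Reduced monomials and their independence as functions\<close>

definition mon :: "nat \<Rightarrow> (nat \<Rightarrow> nat) \<Rightarrow> (nat \<Rightarrow> gf5) \<Rightarrow> gf5" where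
  "mon n e = (\<lambda>z. \<Prod>i<n. z i ^ e i)"

text \<open>Exponents stop at 4 because \<open>x ^ 5 = x\<close> on \<open>gf5\<close>; the zeros
  from \<open>n\<close> on make the exponent function unique.\<close>

definition reduced_exps :: "nat \<Rightarrow> (nat \<Rightarrow> nat) set" where
  "reduced_exps n = {e. (\<forall>i<n. e i \<le> 4) \<and> (\<forall>i\<ge>n. e i = 0)}"

text \<open>Pairing with a product of one-variable dual functions: on combinations of reduced
  monomials it reads off the coefficient of \<open>mon n e\<close>.\<close>

definition mon_coeff :: "nat \<Rightarrow> (nat \<Rightarrow> nat) \<Rightarrow> ((nat \<Rightarrow> gf5) \<Rightarrow> gf5) \<Rightarrow> gf5" where
  "mon_coeff n e f = (\<Sum>z\<in>PiE {..<n} (\<lambda>_. UNIV). f z * (\<Prod>i<n. dual_power (e i) (z i)))"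

text \<open>The sum over all points factors into one-variable sums, to which
  \<open>sum_dual_power\<close> applies.\<close>

lemma mon_coeff_mon:
  assumes "e \<in> reduced_exps n" "f \<in> reduced_exps n"
  shows "mon_coeff n e (mon n f) = (if e = f then 1 else 0)"
proof -
  have "mon_coeff n e (mon n f) =
      (\<Sum>z\<in>PiE {..<n} (\<lambda>_. UNIV). \<Prod>i<n. z i ^ f i * dual_power (e i) (z i))"
    by (simp add: mon_coeff_def mon_def prod.distrib)
  also have "\<dots> = (\<Prod>i<n. \<Sum>x\<in>UNIV. x ^ f i * dual_power (e i) x)"
    by (subst prod_sum_PiE) auto
  also have "\<dots> = (\<Prod>i<n. if e i = f i then 1 else 0)"
    using assms by (intro prod.cong refl sum_dual_power) (auto simp: reduced_exps_def)
  also have "\<dots> = (if \<forall>i<n. e i = f i then 1 else 0)"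
    by (auto intro!: prod_zero)
  also have "(\<forall>i<n. e i = f i) \<longleftrightarrow> e = f"
    using assms by (auto simp: reduced_exps_def fun_eq_iff) (metis not_le)
  finally show ?thesis .
qed

lemma mon_coeff_zero_on_span:
  assumes "f \<in> fun_space.span S" "\<And>g. g \<in> S \<Longrightarrow> mon_coeff n e g = 0"
  shows "mon_coeff n e f = 0"
  using assms(1)
proof (induction rule: fun_space.span_induct_alt)
  case base
  then show ?case by (simp add: mon_coeff_def)
next
  case (step c x y)
  have "mon_coeff n e (scale_fun c x + y) = c * mon_coeff n e x + mon_coeff n e y"
    by (simp add: mon_coeff_def plus_fun_def scale_fun_def distrib_right sum.distrib
        sum_distrib_left mult.assoc)
  then show ?case
    using step assms(2) by (simp add: plus_fun_def)
qed

lemma inj_on_mon: "inj_on (mon n) (reduced_exps n)"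
  by (rule inj_onI) (metis mon_coeff_mon zero_neq_one)

lemma independent_mon: "fun_space.independent (mon n ` reduced_exps n)"
proof
  assume "fun_space.dependent (mon n ` reduced_exps n)"
  then obtain e where e: "e \<in> reduced_exps n"
    and "mon n e \<in> fun_space.span (mon n ` reduced_exps n - {mon n e})"
    by (auto simp: fun_space.dependent_def)
  then have "mon_coeff n e (mon n e) = 0"
    by (elim mon_coeff_zero_on_span) (auto simp: mon_coeff_mon)
  with e show False by (simp add: mon_coeff_mon)
qed

section \<open>Monomials of degree 3, 4 and 5\<close>

definition list_mon :: "nat \<Rightarrow> nat list \<Rightarrow> (nat \<Rightarrow> gf5) \<Rightarrow> gf5" where
  "list_mon d l = (\<lambda>z. \<Prod>t<d. z t ^ (l ! t))"

text \<open>Lists of fixed length and sum are counted by a known binomial coefficient. In contrast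
  to \<open>reduced_exps\<close>, the exponent 5 may occur.\<close>

definition exps :: "nat \<Rightarrow> nat \<Rightarrow> nat list set" where
  "exps d k = {l. length l = d \<and> sum_list l = k}"

lemma card_exps: "card (exps d k) = (k + d - 1) choose k"
  by (simp add: exps_def card_length_sum_list)

lemma finite_exps: "finite (exps d k)"
proof (rule finite_subset)
  show "exps d k \<subseteq> {l. set l \<subseteq> {..k} \<and> length l = d}"
    using member_le_sum_list by (auto simp: exps_def)
qed (simp add: finite_lists_length_eq)

abbreviation exps345 :: "nat \<Rightarrow> nat list set" where
  "exps345 d \<equiv> exps d 3 \<union> exps d 4 \<union> exps d 5"

lemma card_exps345:
  assumes "d > 0"
  shows "card (exps345 d) = ((d + 2) choose 3) + ((d + 3) choose 4) + ((d + 4) choose 5)"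
proof -
  have "exps d 3 \<inter> exps d 4 = {}" "(exps d 3 \<union> exps d 4) \<inter> exps d 5 = {}"
    by (auto simp: exps_def)
  then have "card (exps345 d) = card (exps d 3) + card (exps d 4) + card (exps d 5)"
    by (simp add: card_Un_disjoint finite_exps)
  with assms show ?thesis by (simp add: card_exps add.commute[of d])
qed

text \<open>The low digits \<open>z i\<close> with \<open>i < d\<close> are left out because they
  already occur as the pure fifth powers \<open>z i ^ 5\<close>.\<close>

definition basis_funs :: "nat \<Rightarrow> nat \<Rightarrow> ((nat \<Rightarrow> gf5) \<Rightarrow> gf5) set" where
  "basis_funs d c = (\<lambda>i z. z i) ` {d..<2 * d + c} \<union> list_mon d ` exps345 d"

lemma finite_basis_funs: "finite (basis_funs d c)"
  by (simp add: basis_funs_def finite_exps)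

lemma card_basis_funs_le:
  assumes "d > 0"
  shows "card (basis_funs d c) \<le> c + d + ((d + 2) choose 3) + ((d + 3) choose 4) + ((d + 4) choose 5)"
proof -
  have "card (basis_funs d c) \<le> card ((\<lambda>i (z :: nat \<Rightarrow> gf5). z i) ` {d..<2 * d + c})
      + card (list_mon d ` exps345 d)"
    unfolding basis_funs_def by (rule card_Un_le)
  also have "\<dots> \<le> card {d..<2 * d + c} + card (exps345 d)"
    by (intro add_mono card_image_le) (auto simp: finite_exps)
  finally show ?thesis by (simp add: card_exps345[OF assms])
qed

text \<open>As functions on \<open>gf5\<close>, \<open>x^5\<close> and \<open>x\<close> agree, so the exponent 5 is traded for 1; among
  the monomials of degree 3, 4 and 5 only the pure fifth powers are affected.\<close>

definition reduce_exps :: "nat list \<Rightarrow> nat \<Rightarrow> nat" where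
  "reduce_exps l = (\<lambda>i. if i < length l then (if l ! i = 5 then 1 else l ! i) else 0)"

text \<open>An exponent 5 exhausts the largest admissible degree.\<close>

lemma exps345_five:
  assumes "l \<in> exps345 d" "l ! i = 5" "i < d" "j < d" "j \<noteq> i"
  shows "l ! j = 0"
proof -
  have len: "length l = d" and "sum_list l \<le> 5" using assms(1) by (auto simp: exps_def)
  then have "(\<Sum>k<d. l ! k) \<le> 5" by (simp add: sum_list_sum_nth atLeast0LessThan)
  moreover have "(\<Sum>k\<in>{i, j}. l ! k) \<le> (\<Sum>k<d. l ! k)"
    using assms by (intro sum_mono2) auto
  ultimately show ?thesis using assms by simp
qed

text \<open>Two lists could only collide where one has 5 and the other 1. The first is then zero
  elsewhere, hence so is the second, whose degree would be 1.\<close>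

lemma inj_on_reduce_exps: "inj_on reduce_exps (exps345 d)"
proof (rule inj_onI)
  have aux: "l' ! i = 5" if l: "l \<in> exps345 d" "l' \<in> exps345 d"
    and eq: "reduce_exps l = reduce_exps l'" and i: "i < d" "l ! i = 5" for l l' i
  proof (rule ccontr)
    assume "l' ! i \<noteq> 5"
    have len: "length l = d" "length l' = d" using l by (auto simp: exps_def)
    have "l' ! i = 1"
      using fun_cong[OF eq, of i] i len \<open>l' ! i \<noteq> 5\<close> by (simp add: reduce_exps_def)
    moreover have "l' ! j = 0" if "j < d" "j \<noteq> i" for j
      using fun_cong[OF eq, of j] exps345_five[OF l(1) i(2,1) that] that len
      by (auto simp: reduce_exps_def split: if_splits)
    ultimately have "(\<Sum>j<d. l' ! j) = (\<Sum>j<d. if j = i then 1 else 0)"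
      by (intro sum.cong) auto
    then have "sum_list l' = 1"
      using len i by (simp add: sum_list_sum_nth atLeast0LessThan)
    with l(2) show False by (auto simp: exps_def)
  qed
  fix l l' assume l: "l \<in> exps345 d" "l' \<in> exps345 d" and eq: "reduce_exps l = reduce_exps l'"
  have len: "length l = d" "length l' = d" using l by (auto simp: exps_def)
  show "l = l'"
  proof (rule nth_equalityI)
    fix i assume "i < length l"
    then show "l ! i = l' ! i"
      using aux[OF l eq, of i] aux[OF l(2,1) eq[symmetric], of i] fun_cong[OF eq, of i] len
      by (auto simp: reduce_exps_def split: if_splits)
  qed (simp add: len)
qed

lemma list_mon_eq_mon:
  assumes "length l = d" "d \<le> n"
  shows "list_mon d l = mon n (reduce_exps l)"
proof
  fix z :: "nat \<Rightarrow> gf5"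
  have "mon n (reduce_exps l) z = (\<Prod>i<d. z i ^ reduce_exps l i)"
    unfolding mon_def using assms
    by (intro prod.mono_neutral_right) (auto simp: reduce_exps_def)
  also have "\<dots> = list_mon d l z"
    unfolding list_mon_def using assms
    by (intro prod.cong) (auto simp: reduce_exps_def)
  finally show "list_mon d l z = mon n (reduce_exps l) z" ..
qed

lemma var_eq_mon:
  assumes "i < n"
  shows "(\<lambda>z. z i) = mon n (\<lambda>j. if j = i then 1 else 0)"
proof
  fix z :: "nat \<Rightarrow> gf5"
  have "mon n (\<lambda>j. if j = i then 1 else 0) z = (\<Prod>j\<in>{i}. z j ^ (if j = i then 1 else 0))"
    unfolding mon_def using assms by (intro prod.mono_neutral_right) auto
  then show "z i = mon n (\<lambda>j. if j = i then 1 else 0) z" by simp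
qed

text \<open>After reduction of exponents these functions are distinct reduced monomials in
  \<open>2 * d + c\<close> variables: \<open>A\<close> is supported on indices from \<open>d\<close>
  on, \<open>R\<close> on indices below \<open>d\<close>.\<close>

lemma basis_funs_independent_card:
  assumes "d > 0"
  shows "fun_space.independent (basis_funs d c)" (is ?ind)
    and "card (basis_funs d c) = c + d + ((d + 2) choose 3) + ((d + 3) choose 4) + ((d + 4) choose 5)" (is ?card)
proof -
  define n where "n = 2 * d + c"
  define u :: "nat \<Rightarrow> nat \<Rightarrow> nat" where "u i = (\<lambda>j. if j = i then 1 else 0)" for i
  define A where "A = u ` {d..<n}"
  define R where "R = reduce_exps ` exps345 d"
  have "l ! i \<le> 5" if "l \<in> exps345 d" "i < d" for l i
  proof -
    have "l ! i \<le> sum_list l" using that by (intro member_le_sum_list) (auto simp: exps_def)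
    then show ?thesis using that by (auto simp: exps_def)
  qed
  then have "R \<subseteq> reduced_exps n"
    by (auto simp: R_def reduced_exps_def reduce_exps_def n_def exps_def le_less_Suc_eq
        less_Suc_eq_le numeral_eq_Suc) (metis le_antisym not_less_eq_eq)+
  moreover have "A \<subseteq> reduced_exps n"
    by (auto simp: A_def u_def reduced_exps_def)
  ultimately have AR: "A \<union> R \<subseteq> reduced_exps n" by simp
  have eq: "basis_funs d c = mon n ` (A \<union> R)"
  proof -
    have "(\<lambda>i z. z i) ` {d..<n} = mon n ` A"
      unfolding A_def image_image u_def by (intro image_cong refl var_eq_mon) auto
    moreover have "list_mon d ` exps345 d = mon n ` R"
      unfolding R_def image_image
      by (intro image_cong refl list_mon_eq_mon) (auto simp: exps_def n_def)
    ultimately show ?thesis by (simp add: basis_funs_def n_def image_Un)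
  qed
  show ?ind
    unfolding eq by (rule fun_space.independent_mono[OF independent_mon image_mono[OF AR]])
  have "inj u" by (rule injI) (metis u_def zero_neq_one)
  then have "card A = card {d..<n}"
    unfolding A_def by (metis card_image inj_on_subset subset_UNIV)
  then have cA: "card A = d + c" by (simp add: n_def)
  have "A \<inter> R = {}"
  proof (safe; simp)
    fix e assume "e \<in> A" "e \<in> R"
    then obtain i l where "i \<ge> d" "e = u i" "l \<in> exps345 d" "e = reduce_exps l"
      by (auto simp: A_def R_def)
    then have "u i i = reduce_exps l i" "length l = d" by (auto simp: exps_def)
    with \<open>i \<ge> d\<close> show False by (simp add: u_def reduce_exps_def)
  qed
  moreover have "finite A" "finite R" by (simp_all add: A_def R_def finite_exps)
  moreover have "card R = card (exps345 d)"
    unfolding R_def by (rule card_image[OF inj_on_reduce_exps])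
  ultimately have "card (A \<union> R) = d + c + card (exps345 d)"
    by (simp add: card_Un_disjoint cA)
  moreover have "card (mon n ` (A \<union> R)) = card (A \<union> R)"
    by (rule card_image[OF inj_on_subset[OF inj_on_mon AR]])
  ultimately show ?card by (simp add: eq card_exps345[OF assms])
qed

subsection \<open>Quotients of linear forms\<close>

definition lin_form :: "nat \<Rightarrow> (nat \<Rightarrow> gf5) \<Rightarrow> (nat \<Rightarrow> gf5) \<Rightarrow> gf5" where
  "lin_form d c = (\<lambda>z. \<Sum>t<d. c t * z t)"

text \<open>The multipliers are natural numbers, not elements of \<open>gf5\<close>: the quotient
  depends on them modulo 25, and their sum can serve as an induction measure.\<close>

definition quot_form :: "nat \<Rightarrow> (nat \<Rightarrow> nat) \<Rightarrow> (nat \<Rightarrow> gf5) \<Rightarrow> gf5" where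
  "quot_form d p = (\<lambda>z. of_int ((\<Sum>t<d. int (p t) * lift5 (z t)) div 5))"

lemma lift5_lin_form:
  "lift5 (lin_form d (\<lambda>t. of_nat (p t)) z) = (\<Sum>t<d. int (p t) * lift5 (z t)) mod 5"
proof -
  have "lin_form d (\<lambda>t. of_nat (p t)) z = of_int (\<Sum>t<d. int (p t) * lift5 (z t))"
    by (simp add: lin_form_def)
  then show ?thesis by (simp only: lift5_of_int)
qed

text \<open>The failure of additivity in \<open>p\<close> is exactly a carry of low digits. This
  expresses quotients by carries and, read backwards, carries by quotients.\<close>

lemma quot_form_add:
  "quot_form d (\<lambda>t. p t + q t) z = quot_form d p z + quot_form d q z
     + carry5 (lin_form d (\<lambda>t. of_nat (p t)) z) (lin_form d (\<lambda>t. of_nat (q t)) z)"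
proof -
  have "(\<Sum>t<d. int (p t + q t) * lift5 (z t))
      = (\<Sum>t<d. int (p t) * lift5 (z t)) + (\<Sum>t<d. int (q t) * lift5 (z t))"
    by (simp add: distrib_right sum.distrib)
  then show ?thesis
    using div_add1_eq[of "\<Sum>t<d. int (p t) * lift5 (z t)" "\<Sum>t<d. int (q t) * lift5 (z t)" 5]
    by (simp only: quot_form_def carry5_def lift5_lin_form of_int_add)
qed

definition homog :: "nat \<Rightarrow> nat \<Rightarrow> ((nat \<Rightarrow> gf5) \<Rightarrow> gf5) set" where
  "homog d k = fun_space.span (list_mon d ` exps d k)"

lemma list_mon_update:
  assumes "length l = d" "t < d"
  shows "list_mon d (l[t := Suc (l ! t)]) z = z t * list_mon d l z"
proof -
  have "(\<Prod>i<d. z i ^ (l[t := Suc (l ! t)] ! i)) = (\<Prod>i<d. (if i = t then z t else 1) * z i ^ (l ! i))"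
    using assms by (intro prod.cong) auto
  also have "\<dots> = z t * (\<Prod>i<d. z i ^ (l ! i))"
    using assms by (simp add: prod.distrib)
  finally show ?thesis by (simp add: list_mon_def)
qed

lemma homog_times_var:
  assumes "f \<in> homog d k" "t < d"
  shows "(\<lambda>z. z t * f z) \<in> homog d (Suc k)"
  using assms(1) unfolding homog_def
proof (induction rule: fun_space.span_induct_alt)
  case base
  then show ?case using span_zero_fun by (simp add: zero_fun_def)
next
  case (step c x y)
  then obtain l where l: "length l = d" "sum_list l = k" "x = list_mon d l" by (auto simp: exps_def)
  have "l[t := Suc (l ! t)] \<in> exps d (Suc k)"
    using l assms(2) elem_le_sum_list[of t l] by (auto simp: exps_def sum_list_update)
  then have "list_mon d (l[t := Suc (l ! t)]) \<in> fun_space.span (list_mon d ` exps d (Suc k))"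
    by (intro fun_space.span_base imageI)
  then have "(\<lambda>z. z t * x z) \<in> fun_space.span (list_mon d ` exps d (Suc k))"
    using list_mon_update[OF l(1) assms(2)] l(3) by (metis (no_types, lifting) ext)
  from span_plus[OF span_times[OF this, of c] step.IH]
  have "(\<lambda>z. c * (z t * x z) + z t * y z) \<in> fun_space.span (list_mon d ` exps d (Suc k))" .
  also have "(\<lambda>z. c * (z t * x z) + z t * y z) = (\<lambda>z. z t * (scale_fun c x + y) z)"
    by (rule ext) (simp add: plus_fun_def scale_fun_apply algebra_simps)
  finally show ?case .
qed

lemma homog_times_lin_form:
  assumes "f \<in> homog d k"
  shows "(\<lambda>z. lin_form d c z * f z) \<in> homog d (Suc k)"
proof -
  have "(\<lambda>z. lin_form d c z * f z) = (\<lambda>z. \<Sum>t<d. c t * (z t * f z))"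
    by (simp add: lin_form_def sum_distrib_right mult.assoc)
  also have "\<dots> \<in> homog d (Suc k)"
    using homog_times_var[OF assms] unfolding homog_def
    by (intro span_sum_fun span_times) auto
  finally show ?thesis .
qed

lemma lin_form_powers_homog: "(\<lambda>z. lin_form d c z ^ i * lin_form d c' z ^ j) \<in> homog d (i + j)"
proof (induction i)
  case 0
  show ?case
  proof (induction j)
    case 0
    have "replicate d 0 \<in> exps d 0" by (simp add: exps_def)
    then have "list_mon d (replicate d 0) \<in> homog d 0" unfolding homog_def
      by (intro fun_space.span_base imageI)
    then show ?case by (simp add: list_mon_def)
  next
    case (Suc j)
    from homog_times_lin_form[OF Suc, of c'] show ?case by (simp add: mult.assoc)
  qed
next
  case (Suc i)
  from homog_times_lin_form[OF Suc, of c] show ?case by (simp add: mult.assoc)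
qed

lemma carry5_lin_forms_span:
  "(\<lambda>z. carry5 (lin_form d c z) (lin_form d c' z)) \<in> fun_space.span (list_mon d ` exps345 d)"
    (is "_ \<in> ?S")
proof -
  have S: "(\<lambda>z. lin_form d c z ^ i * lin_form d c' z ^ j) \<in> ?S" if "i + j \<in> {3, 4, 5}" for i j
  proof -
    have "homog d (i + j) \<subseteq> ?S"
      unfolding homog_def using that by (intro fun_space.span_mono) auto
    with lin_form_powers_homog show ?thesis by blast
  qed
  \<comment> \<open>\<open>carry5_poly\<close> with all nine terms in the shape
    \<open>x ^ i * y ^ j\<close>, exponent 1 included, so that \<open>S\<close> applies to
    each.\<close>
  have "(\<lambda>z. carry5 (lin_form d c z) (lin_form d c' z)) =
    (\<lambda>z. (((-1) * (lin_form d c z ^ 4 * lin_form d c' z ^ 1)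
     + (-2) * (lin_form d c z ^ 3 * lin_form d c' z ^ 2))
     + ((-2) * (lin_form d c z ^ 2 * lin_form d c' z ^ 3)
     + (-1) * (lin_form d c z ^ 1 * lin_form d c' z ^ 4)))
     + ((3 * (lin_form d c z ^ 3 * lin_form d c' z ^ 1) + 2 * (lin_form d c z ^ 2 * lin_form d c' z ^ 2))
     + (3 * (lin_form d c z ^ 1 * lin_form d c' z ^ 3) + 4 * (lin_form d c z ^ 2 * lin_form d c' z ^ 1)))
     + 4 * (lin_form d c z ^ 1 * lin_form d c' z ^ 2))"
    by (rule ext) (simp add: carry5_poly algebra_simps)
  also have "\<dots> \<in> ?S"
    by (intro span_plus span_times S) simp_all
  finally show ?thesis .
qed

text \<open>Induction on the sum of the multipliers. Lowering one of them by 1 splits off a unit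
  vector \<open>e\<close>, whose quotient is 0 since a single digit is below 5; what remains is a
  carry of two linear forms.\<close>

lemma quot_form_span: "quot_form d p \<in> fun_space.span (list_mon d ` exps345 d)" (is "_ \<in> ?S")
proof (induction "\<Sum>t<d. p t" arbitrary: p)
  case 0
  then have "quot_form d p = (\<lambda>z. 0)" by (simp add: quot_form_def)
  then show ?case by (simp add: span_zero_fun)
next
  case (Suc s)
  then have "\<exists>t<d. p t > 0" by (metis gr0I lessThan_iff nat.distinct(1) sum.neutral)
  then obtain t where t: "t < d" "p t > 0" by blast
  define q where "q = p(t := p t - 1)"
  define e :: "nat \<Rightarrow> nat" where "e = (\<lambda>i. if i = t then 1 else 0)"
  have p: "p = (\<lambda>i. q i + e i)" using t by (auto simp: q_def e_def)
  have "(\<Sum>i<d. p i) = (\<Sum>i<d. q i) + (\<Sum>i<d. e i)"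
    by (simp add: p sum.distrib)
  also have "(\<Sum>i<d. e i) = 1" using t by (simp add: e_def)
  finally have "s = (\<Sum>i<d. q i)" using Suc.hyps(2) by simp
  then have q: "quot_form d q \<in> ?S" by (rule Suc.hyps(1))
  have "(\<Sum>i<d. int (e i) * lift5 (z i)) = (\<Sum>i<d. if i = t then lift5 (z t) else 0)" for z
    by (intro sum.cong) (auto simp: e_def)
  then have "quot_form d e = (\<lambda>z. 0)"
    using t by (simp add: quot_form_def div_pos_pos_trivial)
  then have "quot_form d p = (\<lambda>z. quot_form d q z
      + carry5 (lin_form d (\<lambda>t. of_nat (q t)) z) (lin_form d (\<lambda>t. of_nat (e t)) z))"
    unfolding p by (intro ext) (simp add: quot_form_add)
  also have "\<dots> \<in> ?S"
    by (intro span_plus q carry5_lin_forms_span)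
  finally show ?case .
qed

text \<open>The witness is the pure fifth power of \<open>z t\<close>.\<close>

lemma var_in_span_list_mon:
  assumes "t < d"
  shows "(\<lambda>z. z t) \<in> list_mon d ` exps345 d"
proof -
  define l :: "nat list" where "l = (replicate d 0)[t := 5]"
  have "l \<in> exps345 d"
    using assms by (auto simp: l_def exps_def sum_list_update)
  moreover have "list_mon d l z = z t" for z
  proof -
    have "list_mon d l z = (\<Prod>i<d. if i = t then z t else 1)"
      unfolding list_mon_def using assms by (intro prod.cong) (auto simp: l_def)
    then show ?thesis using assms by simp
  qed
  ultimately show ?thesis by (metis (no_types, lifting) ext imageI)
qed

lemma var_in_span_basis_funs:
  assumes "i < 2 * d + c"
  shows "(\<lambda>z. z i) \<in> fun_space.span (basis_funs d c)"
proof (cases "i < d")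
  case True
  then show ?thesis
    using var_in_span_list_mon by (intro fun_space.span_base) (auto simp: basis_funs_def)
next
  case False
  with assms show ?thesis by (intro fun_space.span_base) (auto simp: basis_funs_def)
qed

lemma quot_form_span_basis_funs: "quot_form d p \<in> fun_space.span (basis_funs d c)"
  using quot_form_span fun_space.span_mono[of "list_mon d ` exps345 d" "basis_funs d c"]
  by (auto simp: basis_funs_def)

section \<open>Recovering all monomials of degree 3, 4 and 5 from quotients\<close>

lemma list_mon_exps_Suc:
  assumes "l \<in> exps d (Suc k)"
  obtains t l' where "t < d" "l' \<in> exps d k" "list_mon d l = (\<lambda>z. z t * list_mon d l' z)"
proof -
  have l: "length l = d" "sum_list l = Suc k" using assms by (auto simp: exps_def)
  then have "\<exists>t<d. l ! t > 0"
    by (metis gr0I in_set_conv_nth nat.distinct(1) sum_list_eq_0_iff)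
  then obtain t where t: "t < d" "l ! t > 0" by blast
  define l' where "l' = l[t := l ! t - 1]"
  have "l = l'[t := Suc (l' ! t)]" using t l by (simp add: l'_def)
  moreover have "length l' = d" using l by (simp add: l'_def)
  ultimately have "list_mon d l = (\<lambda>z. z t * list_mon d l' z)"
    using list_mon_update[of l' d t] t by (metis (no_types, lifting) ext)
  moreover have "l' \<in> exps d k"
    using l t elem_le_sum_list[of t l] by (auto simp: l'_def exps_def sum_list_update)
  ultimately show thesis using that t by blast
qed

lemma list_mon_exps_0:
  assumes "l \<in> exps d 0"
  shows "list_mon d l = (\<lambda>z. 1)"
  using assms nth_mem by (fastforce simp: exps_def list_mon_def fun_eq_iff intro!: prod.neutral)

lemma list_mon_as_product:
  assumes "l \<in> exps d k"
  obtains ts where "length ts = k" "set ts \<subseteq> {..<d}" "list_mon d l = (\<lambda>z. \<Prod>t\<leftarrow>ts. z t)"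
  using assms
proof (induction k arbitrary: l thesis)
  case 0
  show ?case by (rule 0(1)[of "[]"]) (simp_all add: list_mon_exps_0[OF 0(2)])
next
  case (Suc k)
  obtain t l' where t: "t < d" "l' \<in> exps d k" "list_mon d l = (\<lambda>z. z t * list_mon d l' z)"
    using list_mon_exps_Suc[OF Suc.prems(2)] .
  obtain ts where "length ts = k" "set ts \<subseteq> {..<d}" "list_mon d l' = (\<lambda>z. \<Prod>t\<leftarrow>ts. z t)"
    using Suc.IH[OF _ t(2)] by blast
  with t show ?case by (intro Suc.prems(1)[of "t # ts"]) simp_all
qed

text \<open>Scaling the two arguments of the carry separates its homogeneous parts, and polarization
  of \<open>s ^ 4 * t\<close>, \<open>s ^ 3 * t\<close> and \<open>s ^ 2 * t\<close> yields all products of 3, 4 or 5 linear forms.\<close>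

lemma list_mon_span_of_carries:
  fixes S :: "((nat \<Rightarrow> gf5) \<Rightarrow> gf5) set"
  defines "U \<equiv> fun_space.span S"
  assumes carry: "\<And>c c'. (\<lambda>z. carry5 (lin_form d c z) (lin_form d c' z)) \<in> U"
    and l: "l \<in> exps345 d"
  shows "list_mon d l \<in> U"
proof -
  \<comment> \<open>The linear forms are closed under scaling and addition, so the substitutions
    made by extraction and polarization stay inside \<open>L\<close>.\<close>
  define L where "L = range (lin_form d)"
  have scale_L: "(\<lambda>z. k * s z) \<in> L" if s: "s \<in> L" for k s
  proof -
    obtain c where c: "s = lin_form d c" using s by (auto simp: L_def)
    then have "(\<lambda>z. k * s z) = lin_form d (\<lambda>t. k * c t)"
      by (simp add: lin_form_def sum_distrib_left mult.assoc)
    then show ?thesis by (simp add: L_def)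
  qed
  have add_L: "(\<lambda>z. s z + k * t z) \<in> L" if st: "s \<in> L" "t \<in> L" for k s t
  proof -
    obtain c c' where c: "s = lin_form d c" "t = lin_form d c'" using st by (auto simp: L_def)
    then have "(\<lambda>z. s z + k * t z) = lin_form d (\<lambda>t. c t + k * c' t)"
      by (simp add: lin_form_def sum_distrib_left mult.assoc distrib_right sum.distrib)
    then show ?thesis by (simp add: L_def)
  qed
  have carry_L: "(\<lambda>z. carry5 (s z) (t z)) \<in> U" if "s \<in> L" "t \<in> L" for s t
    using that carry by (auto simp: L_def)
  note U_intros = span_sum_fun[of _ _ S, folded U_def] span_times[of _ S, folded U_def]
    span_plus[of _ S, folded U_def]
  have s4t: "(\<lambda>z. s z ^ 4 * t z) \<in> U" if "s \<in> L" "t \<in> L" for s t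
    unfolding carry5_extract(1) using that by (intro U_intros carry_L scale_L)
  have s3t: "(\<lambda>z. s z ^ 3 * t z) \<in> U" if "s \<in> L" "t \<in> L" for s t
    unfolding carry5_extract(2) using that by (intro U_intros carry_L scale_L)
  have s2t: "(\<lambda>z. s z ^ 2 * t z) \<in> U" if "s \<in> L" "t \<in> L" for s t
    unfolding carry5_extract(3) using that by (intro U_intros carry_L scale_L)
  \<comment> \<open>The passive factor \<open>h\<close> lets the polarizations be chained:
    \<open>pol4\<close>, \<open>pol3\<close> and \<open>pol2\<close> lower the exponent of the
    leading form step by step until every factor is a separate linear form.\<close>
  have pol2: "(\<lambda>z. s z * (t z * h z)) \<in> U"
    if h: "\<And>s. s \<in> L \<Longrightarrow> (\<lambda>z. s z ^ 2 * h z) \<in> U" and st: "s \<in> L" "t \<in> L" for s t h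
  proof -
    have "s z * (t z * h z) = (\<Sum>k\<in>UNIV. (2 * k^3) * ((s z + k * t z)^2 * h z))" for z
      using arg_cong[OF polarize5(1)[of "s z" "t z"], of "\<lambda>x. x * h z"]
      by (simp only: sum_distrib_right mult.assoc)
    then have "(\<lambda>z. s z * (t z * h z)) = (\<lambda>z. \<Sum>k\<in>UNIV. (2 * k^3) * ((s z + k * t z)^2 * h z))" by blast
    also have "\<dots> \<in> U" by (intro U_intros h add_L st)
    finally show ?thesis .
  qed
  have pol3: "(\<lambda>z. s z ^ 2 * (t z * h z)) \<in> U"
    if h: "\<And>s. s \<in> L \<Longrightarrow> (\<lambda>z. s z ^ 3 * h z) \<in> U" and st: "s \<in> L" "t \<in> L" for s t h
  proof -
    have "s z ^ 2 * (t z * h z) = (\<Sum>k\<in>UNIV. (3 * k^3) * ((s z + k * t z)^3 * h z))" for z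
      using arg_cong[OF polarize5(2)[of "s z" "t z"], of "\<lambda>x. x * h z"]
      by (simp only: sum_distrib_right mult.assoc)
    then have "(\<lambda>z. s z ^ 2 * (t z * h z)) = (\<lambda>z. \<Sum>k\<in>UNIV. (3 * k^3) * ((s z + k * t z)^3 * h z))" by blast
    also have "\<dots> \<in> U" by (intro U_intros h add_L st)
    finally show ?thesis .
  qed
  have pol4: "(\<lambda>z. s z ^ 3 * (t z * h z)) \<in> U"
    if h: "\<And>s. s \<in> L \<Longrightarrow> (\<lambda>z. s z ^ 4 * h z) \<in> U" and st: "s \<in> L" "t \<in> L" for s t h
  proof -
    have "s z ^ 3 * (t z * h z) = (\<Sum>k\<in>UNIV. k^3 * ((s z + k * t z)^4 * h z))" for z
      using arg_cong[OF polarize5(3)[of "s z" "t z"], of "\<lambda>x. x * h z"]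
      by (simp only: sum_distrib_right mult.assoc)
    then have "(\<lambda>z. s z ^ 3 * (t z * h z)) = (\<lambda>z. \<Sum>k\<in>UNIV. k^3 * ((s z + k * t z)^4 * h z))" by blast
    also have "\<dots> \<in> U" by (intro U_intros h add_L st)
    finally show ?thesis .
  qed
  have prod3: "(\<lambda>z. s1 z * (s2 z * s3 z)) \<in> U" if "s1 \<in> L" "s2 \<in> L" "s3 \<in> L" for s1 s2 s3
    using that by (intro pol2 s2t)
  have prod4: "(\<lambda>z. s1 z * (s2 z * (s3 z * s4 z))) \<in> U"
    if "s1 \<in> L" "s2 \<in> L" "s3 \<in> L" "s4 \<in> L" for s1 s2 s3 s4
    using that by (intro pol2 pol3 s3t)
  have prod5: "(\<lambda>z. s1 z * (s2 z * (s3 z * (s4 z * s5 z)))) \<in> U"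
    if "s1 \<in> L" "s2 \<in> L" "s3 \<in> L" "s4 \<in> L" "s5 \<in> L" for s1 s2 s3 s4 s5
    using that by (intro pol2 pol3 pol4 s4t)
  have var: "(\<lambda>z. z t) \<in> L" if "t < d" for t
  proof -
    have "(\<Sum>i<d. (if i = t then 1 else 0) * z i) = (\<Sum>i<d. if i = t then z t else 0)"
      for z :: "nat \<Rightarrow> gf5"
      by (intro sum.cong) auto
    then have "(\<lambda>z. z t) = lin_form d (\<lambda>i. if i = t then 1 else 0)"
      using that by (simp add: lin_form_def)
    then show ?thesis by (simp add: L_def)
  qed
  obtain k where k: "l \<in> exps d k" "k = 3 \<or> k = 4 \<or> k = 5" using l by blast
  obtain ts where ts: "length ts = k" "set ts \<subseteq> {..<d}" "list_mon d l = (\<lambda>z. \<Prod>t\<leftarrow>ts. z t)"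
    using list_mon_as_product[OF k(1)] .
  from k(2) show ?thesis
  proof (elim disjE)
    assume "k = 3"
    with ts obtain t1 t2 t3 where "ts = [t1, t2, t3]"
      by (auto simp: numeral_eq_Suc length_Suc_conv)
    with ts show ?thesis using prod3[OF var var var, of t1 t2 t3] by simp
  next
    assume "k = 4"
    with ts obtain t1 t2 t3 t4 where "ts = [t1, t2, t3, t4]"
      by (auto simp: numeral_eq_Suc length_Suc_conv)
    with ts show ?thesis using prod4[OF var var var var, of t1 t2 t3 t4] by simp
  next
    assume "k = 5"
    with ts obtain t1 t2 t3 t4 t5 where "ts = [t1, t2, t3, t4, t5]"
      by (auto simp: numeral_eq_Suc length_Suc_conv)
    with ts show ?thesis using prod5[OF var var var var var, of t1 t2 t3 t4 t5] by simp
  qed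
qed

text \<open>By \<open>quot_form_add\<close> a carry of two linear forms is a combination of three
  quotients, with digits of the coefficients as multipliers.\<close>

lemma list_mon_span_quot_forms:
  assumes "l \<in> exps345 d"
  shows "list_mon d l \<in> fun_space.span (range (quot_form d))"
proof (rule list_mon_span_of_carries[OF _ assms])
  fix c c' :: "nat \<Rightarrow> gf5"
  define p where "p = (\<lambda>t. nat (lift5 (c t)))"
  define q where "q = (\<lambda>t. nat (lift5 (c' t)))"
  have of_nat_nat_lift5: "(of_nat (nat (lift5 x)) :: gf5) = x" for x
    by (metis lift5_nonneg nat_0_le of_int_lift5 of_int_of_nat_eq)
  have "(\<lambda>z. carry5 (lin_form d c z) (lin_form d c' z)) =
      (\<lambda>z. (quot_form d (\<lambda>t. p t + q t) z - quot_form d p z) - quot_form d q z)"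
    by (simp add: quot_form_add) (simp add: p_def q_def of_nat_nat_lift5)
  also have "\<dots> \<in> fun_space.span (range (quot_form d))"
    by (intro span_minus fun_space.span_base) auto
  finally show "(\<lambda>z. carry5 (lin_form d c z) (lin_form d c' z)) \<in> fun_space.span (range (quot_form d))" .
qed

section \<open>Quotients independent modulo the variables\<close>

definition var_funs :: "nat \<Rightarrow> ((nat \<Rightarrow> gf5) \<Rightarrow> gf5) set" where
  "var_funs n = (\<lambda>i z. z i) ` {..<n}"

lemma card_var_funs: "card (var_funs n) = n"
proof -
  have "inj (\<lambda>i (z :: nat \<Rightarrow> gf5). z i)"
  proof (rule injI)
    fix i j :: nat
    assume eq: "(\<lambda>z :: nat \<Rightarrow> gf5. z i) = (\<lambda>z. z j)"
    show "i = j"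
      using fun_cong[OF eq, of "\<lambda>k. if k = i then 1 else 0"] by (simp split: if_splits)
  qed
  then show ?thesis unfolding var_funs_def by (metis card_image card_lessThan inj_on_subset subset_UNIV)
qed

lemma independent_var_funs: "fun_space.independent (var_funs n)"
proof (rule fun_space.independent_mono[OF independent_mon])
  show "var_funs n \<subseteq> mon n ` reduced_exps n"
    unfolding var_funs_def
    by (auto simp: var_eq_mon reduced_exps_def intro!: imageI)
qed

text \<open>The variables \<open>V\<close> extend by quotients to a basis \<open>B\<close> of the
  span of all variables and quotients. It also spans \<open>basis_funs\<close>, so it has at least
  \<open>c + d + (k + d)\<close> elements, and at least \<open>k\<close> of them are quotients
  outside \<open>V\<close>.\<close>

lemma independent_var_quot_forms:
  assumes "d > 0" and k: "k + d \<le> ((d + 2) choose 3) + ((d + 3) choose 4) + ((d + 4) choose 5)"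
  obtains ps :: "nat \<Rightarrow> nat \<Rightarrow> nat"
  where "fun_space.independent (var_funs (2 * d + c) \<union> (\<lambda>i. quot_form d (ps i)) ` {..<k})"
    and "card (var_funs (2 * d + c) \<union> (\<lambda>i. quot_form d (ps i)) ` {..<k}) = 2 * d + c + k"
proof -
  define V where "V = var_funs (2 * d + c)"
  obtain B where B: "V \<subseteq> B" "B \<subseteq> V \<union> range (quot_form d)" "fun_space.independent B"
      "V \<union> range (quot_form d) \<subseteq> fun_space.span B"
    using fun_space.maximal_independent_subset_extend[of V "V \<union> range (quot_form d)"]
      independent_var_funs unfolding V_def by blast
  have "B \<subseteq> fun_space.span (basis_funs d c)"
    using B(2) var_in_span_basis_funs quot_form_span_basis_funs by (auto simp: V_def var_funs_def)
  then have fB: "finite B"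
    using fun_space.independent_span_bound[OF finite_basis_funs B(3)] by simp
  have "fun_space.span (range (quot_form d)) \<subseteq> fun_space.span B"
    using B(4) by (intro fun_space.span_minimal) auto
  then have "basis_funs d c \<subseteq> fun_space.span B"
    using list_mon_span_quot_forms B(4)
    by (auto simp: basis_funs_def V_def var_funs_def)
  from fun_space.independent_span_bound[OF fB basis_funs_independent_card(1)[OF assms(1)] this]
  have "c + d + (k + d) \<le> card B"
    using basis_funs_independent_card(2)[OF assms(1), of c] k by linarith
  moreover have "card (B - V) = card B - (2 * d + c)"
    using B(1) fB finite_subset by (subst card_Diff_subset) (auto simp: V_def card_var_funs)
  ultimately have "k \<le> card (B - V)" by linarith
  then obtain Q where Q: "Q \<subseteq> B - V" "card Q = k" "finite Q"
    using obtain_subset_with_card_n by metis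
  obtain b where b: "bij_betw b {..<k} Q"
    using ex_bij_betw_nat_finite[OF Q(3)] Q(2) by (auto simp: atLeast0LessThan)
  have "\<exists>p. b i = quot_form d p" if "i < k" for i
    using that b Q(1) B(2) by (auto simp: bij_betw_def)
  then obtain ps where ps: "\<And>i. i < k \<Longrightarrow> b i = quot_form d (ps i)" by metis
  have Qeq: "(\<lambda>i. quot_form d (ps i)) ` {..<k} = Q"
    using b ps by (auto simp: bij_betw_def image_def)
  have "fun_space.independent (V \<union> Q)"
    by (rule fun_space.independent_mono[OF B(3)]) (use B(1) Q(1) in auto)
  moreover have "card (V \<union> Q) = 2 * d + c + k"
    using Q B(1) fB finite_subset by (subst card_Un_disjoint) (auto simp: V_def card_var_funs)
  ultimately show thesis using that[of ps] Qeq by (simp add: V_def)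
qed

subsection \<open>Homomorphisms of mixed groups and rank bounds\<close>

lemma carrier_mixed_group:
  "carrier (mixed_group a b) = PiE {..<a} (\<lambda>_. {0..<5}) \<times> PiE {..<b} (\<lambda>_. {0..<25})"
  by (simp add: mixed_group_def carrier_integer_mod_group)

lemma mult_mixed_group:
  "g \<otimes>\<^bsub>mixed_group a b\<^esub> g' =
    (\<lambda>i\<in>{..<a}. (fst g i + fst g' i) mod 5, \<lambda>j\<in>{..<b}. (snd g j + snd g' j) mod 25)"
  by (cases g; cases g') (simp add: mixed_group_def)

lemma one_mixed_group: "\<one>\<^bsub>mixed_group a b\<^esub> = (\<lambda>i\<in>{..<a}. 0, \<lambda>j\<in>{..<b}. 0)"
  by (simp add: mixed_group_def DirProd_def)

lemma group_mixed_group: "group (mixed_group a b)"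
  by (simp add: mixed_group_def DirProd_group)

lemma mixed_group_pow:
  "g \<in> carrier (mixed_group a b) \<Longrightarrow> g [^]\<^bsub>mixed_group a b\<^esub> (n::nat) =
    (\<lambda>i\<in>{..<a}. (int n * fst g i) mod 5, \<lambda>j\<in>{..<b}. (int n * snd g j) mod 25)"
proof (induction n)
  case 0
  then show ?case by (simp add: one_mixed_group restrict_def)
next
  case (Suc n)
  then show ?case
    by (simp add: mult_mixed_group fun_eq_iff restrict_def distrib_right mod_add_left_eq
        add.commute mod_add_right_eq)
qed

lemma mixed_group_memD:
  assumes "g \<in> carrier (mixed_group a b)"
  shows "i < a \<Longrightarrow> 0 \<le> fst g i" "i < a \<Longrightarrow> fst g i < 5"
    "j < b \<Longrightarrow> 0 \<le> snd g j" "j < b \<Longrightarrow> snd g j < 25"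
  using assms by (auto simp: carrier_mixed_group PiE_iff)

lemma mixed_group_eqI:
  assumes "g \<in> carrier (mixed_group m n)" "g' \<in> carrier (mixed_group m n)"
    and "\<And>i. i < m \<Longrightarrow> fst g i = fst g' i" "\<And>j. j < n \<Longrightarrow> snd g j = snd g' j"
  shows "g = g'"
proof (rule prod_eqI)
  show "fst g = fst g'"
    by (rule PiE_ext[of _ "{..<m}"]) (use assms in \<open>auto simp: carrier_mixed_group mem_Times_iff\<close>)
  show "snd g = snd g'"
    by (rule PiE_ext[of _ "{..<n}"]) (use assms in \<open>auto simp: carrier_mixed_group mem_Times_iff\<close>)
qed

definition gen5 :: "nat \<Rightarrow> nat \<Rightarrow> nat \<Rightarrow> (nat \<Rightarrow> int) \<times> (nat \<Rightarrow> int)" where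
  "gen5 a b i = (\<lambda>k\<in>{..<a}. if k = i then 1 else 0, \<lambda>k\<in>{..<b}. 0)"

definition gen25 :: "nat \<Rightarrow> nat \<Rightarrow> nat \<Rightarrow> (nat \<Rightarrow> int) \<times> (nat \<Rightarrow> int)" where
  "gen25 a b j = (\<lambda>k\<in>{..<a}. 0, \<lambda>k\<in>{..<b}. if k = j then 1 else 0)"

lemma gen_in_carrier:
  "gen5 a b i \<in> carrier (mixed_group a b)" "gen25 a b j \<in> carrier (mixed_group a b)"
  by (auto simp: gen5_def gen25_def carrier_mixed_group)

text \<open>Induction on the sum of all coordinates: one is subtracted from a positive
  representative, without wrap-around, and the matching generator is split off.\<close>

lemma mixed_group_additive:
  fixes f :: "(nat \<Rightarrow> int) \<times> (nat \<Rightarrow> int) \<Rightarrow> int"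
  assumes add: "\<And>g g'. g \<in> carrier (mixed_group a b) \<Longrightarrow> g' \<in> carrier (mixed_group a b) \<Longrightarrow>
      [f (g \<otimes>\<^bsub>mixed_group a b\<^esub> g') = f g + f g'] (mod n)"
    and "g \<in> carrier (mixed_group a b)"
  shows "[f g = (\<Sum>i<a. fst g i * f (gen5 a b i)) + (\<Sum>j<b. snd g j * f (gen25 a b j))] (mod n)"
  using assms(2)
proof (induction "nat ((\<Sum>i<a. fst g i) + (\<Sum>j<b. snd g j))" arbitrary: g)
  case 0
  note memD = mixed_group_memD[OF \<open>g \<in> carrier _\<close>]
  have ge: "0 \<le> (\<Sum>i<a. fst g i)" "0 \<le> (\<Sum>j<b. snd g j)"
    using memD by (auto intro!: sum_nonneg)
  with 0 have "(\<Sum>i<a. fst g i) = 0" "(\<Sum>j<b. snd g j) = 0" by linarith+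
  then have "\<forall>i\<in>{..<a}. fst g i = 0" "\<forall>j\<in>{..<b}. snd g j = 0"
    using memD sum_nonneg_eq_0_iff[of "{..<a}" "fst g"] sum_nonneg_eq_0_iff[of "{..<b}" "snd g"]
    by auto
  then have z: "\<forall>i<a. fst g i = 0" "\<forall>j<b. snd g j = 0" by auto
  \<comment> \<open>All coordinates of \<open>g\<close> vanish, so \<open>g\<close> is idempotent
    and additivity forces \<open>f g\<close> to be 0 modulo \<open>n\<close>.\<close>
  have "g \<otimes>\<^bsub>mixed_group a b\<^esub> g = g"
    using z 0(2) by (cases g) (auto simp: mult_mixed_group carrier_mixed_group fun_eq_iff
        restrict_def PiE_iff extensional_def)
  with add[OF 0(2) 0(2)] have "[0 = f g] (mod n)"
    by (metis add_cancel_right_right cong_add_lcancel)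
  moreover have "(\<Sum>i<a. fst g i * f (gen5 a b i)) + (\<Sum>j<b. snd g j * f (gen25 a b j)) = 0"
    using z by simp
  ultimately show ?case by (simp add: cong_sym)
next
  case (Suc s)
  note memD = mixed_group_memD[OF \<open>g \<in> carrier _\<close>]
  obtain x y where g: "g = (x, y)" by fastforce
  have gc: "x \<in> PiE {..<a} (\<lambda>_. {0..<5})" "y \<in> PiE {..<b} (\<lambda>_. {0..<25})"
    using Suc.prems by (auto simp: g carrier_mixed_group)
  have "(\<exists>i<a. x i > 0) \<or> (\<exists>j<b. y j > 0)"
  proof (rule ccontr)
    assume "\<not> ?thesis"
    then have "(\<Sum>i<a. x i) + (\<Sum>j<b. y j) \<le> 0"
      by (intro add_nonpos_nonpos sum_nonpos) (metis lessThan_iff not_less)+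
    with Suc.hyps(2) show False by (simp add: g)
  qed
  then show ?case
  proof (elim disjE exE conjE)
    fix i assume i: "i < a" "x i > 0"
    define g' where "g' = (x(i := x i - 1), y)"
    have "(x(i := x i - 1)) \<in> PiE {..<a} (\<lambda>_. {0..<5})"
    proof (rule PiE_I)
      fix k assume "k \<in> {..<a}"
      then show "(x(i := x i - 1)) k \<in> {0..<5}" using PiE_mem[OF gc(1), of k] i by auto
    next
      fix k assume "k \<notin> {..<a}"
      then show "(x(i := x i - 1)) k = undefined" using PiE_arb[OF gc(1), of k] i by auto
    qed
    with gc(2) have g': "g' \<in> carrier (mixed_group a b)"
      by (simp add: g'_def carrier_mixed_group)
    have "g = g' \<otimes>\<^bsub>mixed_group a b\<^esub> gen5 a b i"
      using gc i by (auto simp: g g'_def gen5_def mult_mixed_group fun_eq_iff restrict_def PiE_iff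
          extensional_def)
    with add[OF g' gen_in_carrier(1)] have 1: "[f g = f g' + f (gen5 a b i)] (mod n)" by simp
    have upd: "(\<Sum>k<a. (x(i := x i - 1)) k * u k) = (\<Sum>k<a. x k * u k) - u i" for u :: "nat \<Rightarrow> int"
    proof -
      have "(\<Sum>k<a. (x(i := x i - 1)) k * u k) = (\<Sum>k<a. x k * u k - (if k = i then u i else 0))"
        by (intro sum.cong) (auto simp: algebra_simps)
      then show ?thesis using i by (simp add: sum_subtractf)
    qed
    have "s = nat ((\<Sum>i<a. fst g' i) + (\<Sum>j<b. snd g' j))"
      using upd[of "\<lambda>_. 1"] Suc.hyps(2) by (simp add: g'_def g)
    from Suc.hyps(1)[OF this g'] 1
    have "[f g = ((\<Sum>i<a. fst g' i * f (gen5 a b i)) + (\<Sum>j<b. snd g' j * f (gen25 a b j)))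
        + f (gen5 a b i)] (mod n)"
      by (meson cong_add_rcancel cong_trans)
    then show ?thesis using upd[of "\<lambda>k. f (gen5 a b k)"] by (simp add: g g'_def add_ac)
  next
    fix i assume i: "i < b" "y i > 0"
    define g' where "g' = (x, y(i := y i - 1))"
    have "(y(i := y i - 1)) \<in> PiE {..<b} (\<lambda>_. {0..<25})"
    proof (rule PiE_I)
      fix k assume "k \<in> {..<b}"
      then show "(y(i := y i - 1)) k \<in> {0..<25}" using PiE_mem[OF gc(2), of k] i by auto
    next
      fix k assume "k \<notin> {..<b}"
      then show "(y(i := y i - 1)) k = undefined" using PiE_arb[OF gc(2), of k] i by auto
    qed
    with gc(1) have g': "g' \<in> carrier (mixed_group a b)"
      by (simp add: g'_def carrier_mixed_group)
    have "g = g' \<otimes>\<^bsub>mixed_group a b\<^esub> gen25 a b i"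
      using gc i by (auto simp: g g'_def gen25_def mult_mixed_group fun_eq_iff restrict_def PiE_iff
          extensional_def)
    with add[OF g' gen_in_carrier(2)] have 1: "[f g = f g' + f (gen25 a b i)] (mod n)" by simp
    have upd: "(\<Sum>k<b. (y(i := y i - 1)) k * u k) = (\<Sum>k<b. y k * u k) - u i" for u :: "nat \<Rightarrow> int"
    proof -
      have "(\<Sum>k<b. (y(i := y i - 1)) k * u k) = (\<Sum>k<b. y k * u k - (if k = i then u i else 0))"
        by (intro sum.cong) (auto simp: algebra_simps)
      then show ?thesis using i by (simp add: sum_subtractf)
    qed
    have "s = nat ((\<Sum>i<a. fst g' i) + (\<Sum>j<b. snd g' j))"
      using upd[of "\<lambda>_. 1"] Suc.hyps(2) by (simp add: g'_def g)
    from Suc.hyps(1)[OF this g'] 1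
    have "[f g = ((\<Sum>i<a. fst g' i * f (gen5 a b i)) + (\<Sum>j<b. snd g' j * f (gen25 a b j)))
        + f (gen25 a b i)] (mod n)"
      by (meson cong_add_rcancel cong_trans)
    then show ?thesis using upd[of "\<lambda>k. f (gen25 a b k)"] by (simp add: g g'_def add_ac)
  qed
qed

text \<open>The first \<open>d\<close> entries of \<open>z\<close> are the low and the next \<open>d\<close> entries the high base-5 digits
  of the \<open>\<int>\<^sub>2\<^sub>5\<close> coordinates; the entries from \<open>2 * d\<close> on are the \<open>\<int>\<^sub>5\<close> coordinates.\<close>

definition decode :: "nat \<Rightarrow> nat \<Rightarrow> (nat \<Rightarrow> gf5) \<Rightarrow> (nat \<Rightarrow> int) \<times> (nat \<Rightarrow> int)" where
  "decode c d z =
    (\<lambda>i\<in>{..<c}. lift5 (z (2 * d + i)), \<lambda>t\<in>{..<d}. lift5 (z t) + 5 * lift5 (z (d + t)))"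

lemma fst_decode: "i < c \<Longrightarrow> fst (decode c d z) i = lift5 (z (2 * d + i))"
  and snd_decode: "t < d \<Longrightarrow> snd (decode c d z) t = lift5 (z t) + 5 * lift5 (z (d + t))"
  by (simp_all add: decode_def)

lemma decode_in_carrier: "decode c d z \<in> carrier (mixed_group c d)"
proof -
  have "lift5 (z t) + 5 * lift5 (z (d + t)) < 25" for t
    using lift5_less[of "z t"] lift5_less[of "z (d + t)"] by linarith
  then show ?thesis by (auto simp: decode_def carrier_mixed_group)
qed

lemma range_decode: "range (decode c d) = carrier (mixed_group c d)"
proof
  show "carrier (mixed_group c d) \<subseteq> range (decode c d)"
  proof
    fix g assume g: "g \<in> carrier (mixed_group c d)"
    define z :: "nat \<Rightarrow> gf5" where
      "z = (\<lambda>k. if k < d then of_int (snd g k) else if k < 2 * d then of_int (snd g (k - d) div 5)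
        else of_int (fst g (k - 2 * d)))"
    have 1: "snd g t mod 5 + 5 * (snd g t div 5 mod 5) = snd g t" if "t < d" for t
      using mixed_group_memD(3,4)[OF g that] by presburger
    have 2: "fst g i mod 5 = fst g i" if "i < c" for i
      using mixed_group_memD(1,2)[OF g that] by simp
    have "fst (decode c d z) = fst g"
      using g 2 by (auto simp: decode_def z_def fun_eq_iff restrict_def carrier_mixed_group PiE_iff
          extensional_def)
    moreover have "snd (decode c d z) = snd g"
      using g 1 by (auto simp: decode_def z_def fun_eq_iff restrict_def carrier_mixed_group PiE_iff
          extensional_def)
    ultimately show "g \<in> range (decode c d)" by (metis prod_eqI rangeI)
  qed
qed (use decode_in_carrier in auto)

lemma hom_fst_cong:
  assumes h: "h \<in> hom (mixed_group c d) (mixed_group a b)" and "i < a"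
    and "g \<in> carrier (mixed_group c d)"
  shows "[fst (h g) i = (\<Sum>k<c. fst g k * fst (h (gen5 c d k)) i)
    + (\<Sum>t<d. snd g t * fst (h (gen25 c d t)) i)] (mod 5)"
  using assms(3)
proof (rule mixed_group_additive[rotated])
  fix g g' assume "g \<in> carrier (mixed_group c d)" "g' \<in> carrier (mixed_group c d)"
  from hom_mult[OF h this] assms(2)
  show "[fst (h (g \<otimes>\<^bsub>mixed_group c d\<^esub> g')) i = fst (h g) i + fst (h g') i] (mod 5)"
    by (simp only: mult_mixed_group[where g = "h g"]) (simp add: cong_def)
qed

lemma hom_snd_cong:
  assumes h: "h \<in> hom (mixed_group c d) (mixed_group a b)" and "j < b"
    and "g \<in> carrier (mixed_group c d)"
  shows "[snd (h g) j = (\<Sum>k<c. fst g k * snd (h (gen5 c d k)) j)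
    + (\<Sum>t<d. snd g t * snd (h (gen25 c d t)) j)] (mod 25)"
  using assms(3)
proof (rule mixed_group_additive[rotated])
  fix g g' assume "g \<in> carrier (mixed_group c d)" "g' \<in> carrier (mixed_group c d)"
  from hom_mult[OF h this] assms(2)
  show "[snd (h (g \<otimes>\<^bsub>mixed_group c d\<^esub> g')) j = snd (h g) j + snd (h g') j] (mod 25)"
    by (simp only: mult_mixed_group[where g = "h g"]) (simp add: cong_def)
qed

text \<open>The generator is killed by 5, so 5 times its image vanishes modulo 25.\<close>

lemma hom_gen5_dvd:
  assumes h: "h \<in> hom (mixed_group c d) (mixed_group a b)" and "j < b" "k < c"
  shows "5 dvd snd (h (gen5 c d k)) j"
proof -
  let ?g = "gen5 c d k"
  have "h \<one>\<^bsub>mixed_group c d\<^esub> = \<one>\<^bsub>mixed_group a b\<^esub>"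
    by (rule hom_one[OF h group_mixed_group group_mixed_group])
  moreover have "?g [^]\<^bsub>mixed_group c d\<^esub> (5::nat) = \<one>\<^bsub>mixed_group c d\<^esub>"
    by (subst mixed_group_pow[OF gen_in_carrier(1)])
      (auto simp: one_mixed_group gen5_def fun_eq_iff)
  moreover have "h (?g [^]\<^bsub>mixed_group c d\<^esub> (5::nat)) = h ?g [^]\<^bsub>mixed_group a b\<^esub> (5::nat)"
    by (rule group_hom.hom_nat_pow)
      (simp_all add: group_hom_def group_hom_axioms_def h group_mixed_group gen_in_carrier)
  ultimately have "h ?g [^]\<^bsub>mixed_group a b\<^esub> (5::nat) = \<one>\<^bsub>mixed_group a b\<^esub>" by simp
  moreover have "h ?g \<in> carrier (mixed_group a b)"
    by (rule hom_in_carrier[OF h gen_in_carrier(1)])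
  ultimately have "(\<lambda>j\<in>{..<b}. (5 * snd (h ?g) j) mod 25) = (\<lambda>j\<in>{..<b}. 0)"
    by (simp add: mixed_group_pow one_mixed_group)
  from fun_cong[OF this, of j] assms(2) have "(5 * snd (h ?g) j) mod 25 = 0" by simp
  then show ?thesis by presburger
qed

lemma rank_le_card:
  assumes "Gray Y a b ` C \<subseteq> fun_space.span M" "finite M"
  shows "rank (Gray Y a b ` C) \<le> card M"
  unfolding rank_def word_space.dim_span
  using assms by (intro word_space.dim_le_card) (auto simp: scale_word_eq_scale_fun)

context
  fixes h a b c d
  assumes h: "h \<in> hom (mixed_group c d) (mixed_group a b)"
begin

lemma hom_decode_fst:
  assumes "i < a"
  shows "(of_int (fst (h (decode c d z)) i) :: gf5) =
    (\<Sum>k<c. of_int (fst (h (gen5 c d k)) i) * z (2 * d + k))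
    + (\<Sum>t<d. of_int (fst (h (gen25 c d t)) i) * z t)"
  using of_int_gf5_cong[OF hom_fst_cong[OF h assms decode_in_carrier, of z]]
  by (simp add: fst_decode snd_decode mult.commute)

text \<open>Modulo 25 the coordinate is \<open>5 * A + S\<close>: \<open>A\<close> collects the
  order 5 generators, whose images are divisible by 5, and the high digits, while \<open>S\<close>
  collects the low digits. Division by 5 leaves \<open>A\<close> plus the quotient of
  \<open>S\<close>.\<close>

lemma hom_decode_snd:
  assumes "j < b"
  shows "of_int (snd (h (decode c d z)) j) =
      lin_form d (\<lambda>t. of_int (snd (h (gen25 c d t)) j)) z" (is ?low)
    and "of_int (snd (h (decode c d z)) j div 5) =
      (\<Sum>k<c. of_int (snd (h (gen5 c d k)) j div 5) * z (2 * d + k))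
      + (\<Sum>t<d. of_int (snd (h (gen25 c d t)) j) * z (d + t))
      + quot_form d (\<lambda>t. nat (snd (h (gen25 c d t)) j)) z" (is ?high)
proof -
  define y where "y = snd (h (decode c d z)) j"
  define Z where "Z = (\<lambda>k. snd (h (gen5 c d k)) j div 5)"
  define P where "P = (\<lambda>t. snd (h (gen25 c d t)) j)"
  define A where "A = (\<Sum>k<c. Z k * lift5 (z (2 * d + k))) + (\<Sum>t<d. P t * lift5 (z (d + t)))"
  define S where "S = (\<Sum>t<d. P t * lift5 (z t))"
  have P: "P t \<ge> 0" if "t < d" for t
    unfolding P_def
    by (rule mixed_group_memD(3)[OF hom_in_carrier[OF h gen_in_carrier(2)] assms])
  have "(\<Sum>k<c. fst (decode c d z) k * snd (h (gen5 c d k)) j) = 5 * (\<Sum>k<c. Z k * lift5 (z (2 * d + k)))"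
    unfolding sum_distrib_left using hom_gen5_dvd[OF h assms]
    by (intro sum.cong) (auto simp: fst_decode Z_def)
  moreover have "(\<Sum>t<d. snd (decode c d z) t * snd (h (gen25 c d t)) j)
      = S + 5 * (\<Sum>t<d. P t * lift5 (z (d + t)))"
    unfolding sum_distrib_left S_def sum.distrib[symmetric]
    by (intro sum.cong) (auto simp: snd_decode P_def algebra_simps)
  ultimately have "[y = 5 * A + S] (mod 25)"
    using hom_snd_cong[OF h assms decode_in_carrier, of z] by (simp add: y_def A_def algebra_simps)
  then obtain q where q: "y = 5 * A + S + 25 * q"
    by (metis cong_iff_lin cong_sym)
  have "of_int y = (of_int S :: gf5)"
    unfolding q by (simp add: numeral_gf5_eq_iff)
  then show ?low by (simp add: y_def S_def P_def lin_form_def)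
  have "y = S + 5 * (A + 5 * q)" by (simp add: q)
  then have "y div 5 = A + S div 5 + 5 * q" by (simp only: div_mult_self2)
  then have "(of_int (y div 5) :: gf5) = of_int A + of_int (S div 5)" by simp
  moreover have "quot_form d (\<lambda>t. nat (P t)) z = of_int (S div 5)"
    using P by (simp add: quot_form_def S_def)
  ultimately show ?high by (simp add: A_def y_def Z_def P_def)
qed

lemma Gray_column_span:
  "(\<lambda>z. Gray Y a b (h (decode c d z)) i) \<in> fun_space.span (basis_funs d c)"
proof -
  have var: "(\<lambda>z. z k) \<in> fun_space.span (basis_funs d c)" if "k < 2 * d + c" for k
    using that by (rule var_in_span_basis_funs)
  note intros = span_plus span_sum_fun span_times var quot_form_span_basis_funs
  consider "i < a" | "a \<le> i" "i < a + 5 * b" | "a + 5 * b \<le> i" by linarith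
  then show ?thesis
  proof cases
    case 1
    then have "(\<lambda>z. Gray Y a b (h (decode c d z)) i) =
        (\<lambda>z. (\<Sum>k<c. of_int (fst (h (gen5 c d k)) i) * z (2 * d + k))
      + (\<Sum>t<d. of_int (fst (h (gen25 c d t)) i) * z t))"
      by (simp add: Gray_def case_prod_unfold hom_decode_fst)
    also have "\<dots> \<in> fun_space.span (basis_funs d c)" by (intro intros) auto
    finally show ?thesis .
  next
    case 2
    define j where "j = (i - a) div 5"
    from 2 have j: "j < b" by (auto simp: j_def)
    have "(\<lambda>z. Gray Y a b (h (decode c d z)) i) =
        (\<lambda>z. of_int (snd (h (decode c d z)) j div 5) + Y ((i - a) mod 5) * of_int (snd (h (decode c d z)) j))"
      using 2 by (simp add: Gray_def case_prod_unfold gray_def j_def mult.commute)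
    also have "\<dots> \<in> fun_space.span (basis_funs d c)"
      unfolding hom_decode_snd[OF j] lin_form_def by (intro intros) auto
    finally show ?thesis .
  next
    case 3
    then have "(\<lambda>z. Gray Y a b (h (decode c d z)) i) = (\<lambda>z. 0)"
      by (simp add: Gray_def case_prod_unfold)
    then show ?thesis by (simp add: span_zero_fun)
  qed
qed

lemma Gray_image_eq_range:
  "Gray Y a b ` h ` carrier (mixed_group c d) = range (\<lambda>z. Gray Y a b (h (decode c d z)))"
  by (simp add: range_decode[symmetric] image_image)

text \<open>Transposition: the coordinate functions lie in the span of \<open>basis_funs\<close>, so
  the words lie in the span of no more words than that.\<close>

lemma rank_le_basis_funs:
  "rank (Gray Y a b ` h ` carrier (mixed_group c d)) \<le> card (basis_funs d c)"
proof -
  obtain M where M: "finite M" "card M \<le> card (basis_funs d c)"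
    "\<And>z. (\<lambda>i. Gray Y a b (h (decode c d z)) i) \<in> fun_space.span M"
    using column_span_of_row_span[of "\<lambda>i z. Gray Y a b (h (decode c d z)) i" "basis_funs d c"]
      Gray_column_span finite_basis_funs by metis
  have "Gray Y a b ` h ` carrier (mixed_group c d) \<subseteq> fun_space.span M"
    using M(3) by (auto simp: Gray_image_eq_range)
  from rank_le_card[OF this M(1)] M(2) show ?thesis by linarith
qed

text \<open>A word splits into three parts: a word from the order 5 subcode seen on the first
  \<open>a\<close> coordinates, a combination of \<open>d\<close> words for the low digits of
  \<open>z\<close>, and one constant block for each coordinate in \<open>J\<close>, carrying its
  high digit.\<close>

lemma rank_le_support:
  assumes J: "J \<subseteq> {..<b}"
      "\<And>g j. g \<in> carrier (mixed_group c d) \<Longrightarrow> j < b \<Longrightarrow> j \<notin> J \<Longrightarrow> snd (h g) j = 0"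
  shows "rank (Gray Y a b ` h ` carrier (mixed_group c d)) \<le>
    word_space.dim (first_coords a ` order5_subcode a b (h ` carrier (mixed_group c d))) + d + card J"
proof -
  define K where "K = first_coords a ` order5_subcode a b (h ` carrier (mixed_group c d))"
  have "finite (carrier (mixed_group c d))"
    by (simp add: carrier_mixed_group finite_PiE)
  then have "finite K" by (simp add: K_def order5_subcode_def)
  obtain K0 where K0: "K0 \<subseteq> K" "K \<subseteq> fun_space.span K0" "card K0 = word_space.dim K"
    using word_space.basis_exists[of K] by (metis scale_word_eq_scale_fun)
  have fK0: "finite K0" using K0(1) \<open>finite K\<close> finite_subset by blast
  \<comment> \<open>The Gray image without the high digits; unlike the full image it depends
    linearly on \<open>z\<close>.\<close>
  define \<tau> where "\<tau> = (\<lambda>g i. if i < a then of_int (fst g i) else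
    if i < a + 5 * b then of_int (snd g ((i - a) div 5)) * Y ((i - a) mod 5) else (0 :: gf5))"
  \<comment> \<open>The block of five ones at coordinate \<open>j\<close>, by which a high digit
    enters the Gray image.\<close>
  define ind where "ind = (\<lambda>j i. if a \<le> i \<and> i < a + 5 * b \<and> (i - a) div 5 = j then 1 else (0 :: gf5))"
  define W where "W = K0 \<union> (\<lambda>t. \<tau> (h (gen25 c d t))) ` {..<d} \<union> ind ` J"
  have fJ: "finite J" using J(1) finite_subset by blast
  have "Gray Y a b (h (decode c d z)) \<in> fun_space.span W" for z
  proof -
    \<comment> \<open>Clearing the low digits makes all \<int>/25 coordinates of \<open>h g'\<close>
      divisible by 5. So \<open>h g'\<close> lies in the order 5 subcode, and \<open>\<tau>\<close>
      reduces there to \<open>first_coords\<close>.\<close>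
    define z' where "z' = (\<lambda>k. if k < d then 0 else z k)"
    define g where "g = decode c d z"
    define g' where "g' = decode c d z'"
    have car: "h g \<in> carrier (mixed_group a b)" "h g' \<in> carrier (mixed_group a b)"
      unfolding g_def g'_def by (intro hom_in_carrier[OF h decode_in_carrier])+
    have snd_g': "(of_int (snd (h g') j) :: gf5) = 0" if "j < b" for j
      using that by (simp add: g'_def hom_decode_snd lin_form_def z'_def)
    have "(5 * snd (h g') j) mod 25 = 0" if "j < b" for j
    proof -
      have "snd (h g') j mod 5 = 0"
        using snd_g'[OF that] of_int_gf5_eq_iff[of "snd (h g') j" 0] by simp
      then show ?thesis by presburger
    qed
    then have "h g' [^]\<^bsub>mixed_group a b\<^esub> (5::nat) = \<one>\<^bsub>mixed_group a b\<^esub>"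
      by (auto simp: mixed_group_pow[OF car(2)] one_mixed_group fun_eq_iff)
    then have "h g' \<in> order5_subcode a b (h ` carrier (mixed_group c d))"
      using decode_in_carrier by (auto simp: order5_subcode_def g'_def)
    then have "first_coords a (h g') \<in> K" by (simp add: K_def)
    moreover have "first_coords a (h g') = \<tau> (h g')"
      using snd_g' by (auto simp: first_coords_def case_prod_unfold \<tau>_def fun_eq_iff)
    ultimately have "\<tau> (h g') \<in> fun_space.span K0" using K0(2) by auto
    then have 1: "\<tau> (h g') \<in> fun_space.span W"
      using fun_space.span_mono[of K0 W] by (auto simp: W_def)
    have "\<tau> (h g) i = \<tau> (h g') i + (\<Sum>t<d. z t * \<tau> (h (gen25 c d t)) i)" for i
    proof -
      have div: "(i - a) div 5 < b" if "\<not> i < a" "i < a + 5 * b" using that by auto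
      show ?thesis
        using div by (auto simp: \<tau>_def g_def g'_def hom_decode_fst hom_decode_snd lin_form_def z'_def
            sum_distrib_left sum_distrib_right mult_ac)
    qed
    moreover have "Gray Y a b (h g) i = \<tau> (h g) i + (\<Sum>j\<in>J. of_int (snd (h g) j div 5) * ind j i)" for i
    proof (cases "a \<le> i \<and> i < a + 5 * b")
      case True
      define j where "j = (i - a) div 5"
      have j: "j < b" using True by (auto simp: j_def)
      have "(\<Sum>k\<in>J. of_int (snd (h g) k div 5) * ind k i)
          = (\<Sum>k\<in>J. if k = j then of_int (snd (h g) j div 5) else 0)"
        using True by (intro sum.cong) (auto simp: ind_def j_def)
      also have "\<dots> = of_int (snd (h g) j div 5)"
        using fJ J(2)[OF decode_in_carrier j, of z] by (simp add: g_def)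
      finally show ?thesis
        using True by (simp add: Gray_def case_prod_unfold \<tau>_def gray_def j_def)
    next
      case False
      then show ?thesis by (auto simp: Gray_def case_prod_unfold \<tau>_def ind_def)
    qed
    ultimately have "Gray Y a b (h g) = (\<lambda>i. (\<tau> (h g') i + (\<Sum>t<d. z t * \<tau> (h (gen25 c d t)) i))
        + (\<Sum>j\<in>J. of_int (snd (h g) j div 5) * ind j i))"
      by (intro ext) simp
    also have "\<dots> \<in> fun_space.span W"
      by (intro span_plus 1 span_sum_fun span_times fun_space.span_base) (auto simp: W_def)
    finally show ?thesis by (simp add: g_def)
  qed
  then have "Gray Y a b ` h ` carrier (mixed_group c d) \<subseteq> fun_space.span W"
    by (auto simp: Gray_image_eq_range)
  moreover have "finite W" using fK0 fJ by (simp add: W_def)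
  ultimately have "rank (Gray Y a b ` h ` carrier (mixed_group c d)) \<le> card W"
    by (rule rank_le_card)
  also have "card W \<le> card K0 + card ((\<lambda>t. \<tau> (h (gen25 c d t))) ` {..<d}) + card (ind ` J)"
    unfolding W_def by (meson add_le_mono card_Un_le le_refl order_trans)
  also have "\<dots> \<le> card K0 + d + card J"
    using card_image_le[of "{..<d}" "\<lambda>t. \<tau> (h (gen25 c d t))"] card_image_le[OF fJ, of ind] by simp
  finally show ?thesis by (simp add: K0(3) K_def)
qed

end

section \<open>Lower bound for the rank by counting codewords\<close>

lemma card_le_rank:
  assumes "finite V"
  shows "card V \<le> 5 ^ rank V"
proof -
  obtain B where B: "B \<subseteq> V" "V \<subseteq> fun_space.span B" "card B = word_space.dim V"
    using word_space.basis_exists[of V] by (metis scale_word_eq_scale_fun)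
  have fB: "finite B" using B(1) assms finite_subset by blast
  have "V \<subseteq> (\<lambda>u. \<Sum>v\<in>B. scale_fun (u v) v) ` PiE B (\<lambda>_. UNIV)"
  proof
    fix w assume "w \<in> V"
    then obtain u where u: "w = (\<Sum>v\<in>B. scale_fun (u v) v)"
      using B(2) by (auto simp: fun_space.span_finite[OF fB])
    then have "w = (\<Sum>v\<in>B. scale_fun (restrict u B v) v)" by (simp cong: sum.cong)
    then show "w \<in> (\<lambda>u. \<Sum>v\<in>B. scale_fun (u v) v) ` PiE B (\<lambda>_. UNIV)"
      by (intro image_eqI[where x = "restrict u B"]) simp_all
  qed
  then have "card V \<le> card (PiE B (\<lambda>_. UNIV :: gf5 set))"
    by (meson card_image_le card_mono fB finite_PiE finite_imageI finite le_trans)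
  also have "\<dots> = 5 ^ card B" using fB by (simp add: card_PiE card_finite_5)
  finally show ?thesis by (simp add: B(3) rank_def)
qed

text \<open>The difference of two entries of a block is the low digit times
  \<open>Y 0 - Y 1\<close>; given the low digit, one entry determines the high digit.\<close>

lemma inj_on_Gray:
  assumes Y: "Y 0 \<noteq> Y 1"
  shows "inj_on (Gray Y a b) (carrier (mixed_group a b))"
proof (rule inj_onI)
  fix g g' assume g: "g \<in> carrier (mixed_group a b)" "g' \<in> carrier (mixed_group a b)"
    and eq: "Gray Y a b g = Gray Y a b g'"
  have "fst g i = fst g' i" if "i < a" for i
  proof -
    have "(of_int (fst g i) :: gf5) = of_int (fst g' i)"
      using fun_cong[OF eq, of i] that by (simp add: Gray_def case_prod_unfold)
    then show ?thesis
      using mixed_group_memD(1,2)[OF g(1) that] mixed_group_memD(1,2)[OF g(2) that]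
      by (simp add: of_int_gf5_eq_iff)
  qed
  moreover have "snd g j = snd g' j" if "j < b" for j
  proof -
    have col: "(a + 5 * j + k - a) div 5 = j" "(a + 5 * j + k - a) mod 5 = k"
      "a + 5 * j + k < a + 5 * b" "\<not> a + 5 * j + k < a" if "k < 5" for k
      using that \<open>j < b\<close> by auto
    have "gray Y (snd g j) k = gray Y (snd g' j) k" if "k < 5" for k
      using fun_cong[OF eq, of "a + 5 * j + k"] col[OF that]
      by (simp add: Gray_def case_prod_unfold del: add_diff_cancel_left' diff_add_inverse)
    from this[of 0] this[of 1]
    have e: "(of_int (snd g j div 5) :: gf5) + of_int (snd g j) * Y 0
        = of_int (snd g' j div 5) + of_int (snd g' j) * Y 0"
      "(of_int (snd g j div 5) :: gf5) + of_int (snd g j) * Y 1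
        = of_int (snd g' j div 5) + of_int (snd g' j) * Y 1"
      by (simp_all add: gray_def)
    have "(of_int (snd g j) - of_int (snd g' j)) * (Y 0 - Y 1) =
        ((of_int (snd g j div 5) + of_int (snd g j) * Y 0)
          - (of_int (snd g' j div 5) + of_int (snd g' j) * Y 0))
        - ((of_int (snd g j div 5) + of_int (snd g j) * Y 1)
          - (of_int (snd g' j div 5) + of_int (snd g' j) * Y 1))"
      by (simp add: algebra_simps)
    also have "\<dots> = 0" unfolding e by simp
    finally have "(of_int (snd g j) - of_int (snd g' j)) * (Y 0 - Y 1) = 0" .
    with Y have low: "(of_int (snd g j) :: gf5) = of_int (snd g' j)" by simp
    with e(1) have "(of_int (snd g j div 5) :: gf5) = of_int (snd g' j div 5)" by simp
    moreover have "u = 5 * (u div 5 mod 5) + u mod 5" if "0 \<le> u" "u < 25" for u :: int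
      using that by presburger
    ultimately show ?thesis
      using low mixed_group_memD(3,4)[OF g(1) that] mixed_group_memD(3,4)[OF g(2) that]
      unfolding of_int_gf5_eq_iff by metis
  qed
  ultimately show "g = g'" by (rule mixed_group_eqI[OF g])
qed

lemma card_mixed_group: "card (carrier (mixed_group c d)) = 5 ^ (c + 2 * d)"
proof -
  have "(25 :: nat) ^ d = 5 ^ (2 * d)" by (simp add: power_mult)
  then show ?thesis
    by (simp add: carrier_mixed_group card_cartesian_product card_PiE power_add)
qed

lemma rank_ge:
  assumes "Y 0 \<noteq> Y 1" and C: "C \<subseteq> carrier (mixed_group a b)" "card C = 5 ^ (c + 2 * d)"
  shows "c + 2 * d \<le> rank (Gray Y a b ` C)"
proof -
  have "finite C" using C(2) by (metis card.infinite power_eq_0_iff zero_neq_numeral)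
  have "5 ^ (c + 2 * d) = card (Gray Y a b ` C)"
    using C card_image[OF inj_on_subset[OF inj_on_Gray[OF assms(1)] C(1)]] by simp
  also have "\<dots> \<le> 5 ^ rank (Gray Y a b ` C)"
    using \<open>finite C\<close> by (intro card_le_rank) simp
  finally show ?thesis by simp
qed

subsection \<open>Codes of prescribed rank\<close>

text \<open>The first \<open>e\<close> generators of order 5 go to \<open>\<int>\<^sub>5\<close> coordinates and the other \<open>f\<close> to
  \<open>\<int>\<^sub>2\<^sub>5\<close> coordinates; the generators of order 25 get an identity block followed by the \<open>k\<close>
  columns \<open>ps 0, \<dots>, ps (k - 1)\<close>, each of which adds one to the rank if the associated quotients
  are independent.\<close>

definition code_hom :: "nat \<Rightarrow> nat \<Rightarrow> nat \<Rightarrow> nat \<Rightarrow> nat \<Rightarrow> nat \<Rightarrow> (nat \<Rightarrow> nat \<Rightarrow> nat) \<Rightarrow>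
    (nat \<Rightarrow> int) \<times> (nat \<Rightarrow> int) \<Rightarrow> (nat \<Rightarrow> int) \<times> (nat \<Rightarrow> int)" where
  "code_hom a b e f d k ps = (\<lambda>(x, y).
    (\<lambda>i\<in>{..<a}. if i < e then x i else 0,
     \<lambda>j\<in>{..<b}. if j < f then 5 * x (e + j)
       else if j < f + d then y (j - f)
       else if j < f + d + k then (\<Sum>t<d. int (ps (j - (f + d)) t) * y t) mod 25
       else 0))"

lemma dim_supported_words: "word_space.dim {w. \<forall>i\<ge>e. w i = 0} = e"
proof -
  define u :: "nat \<Rightarrow> nat \<Rightarrow> gf5" where "u i = (\<lambda>j. if j = i then 1 else 0)" for i
  have u_inj: "inj u" by (rule injI) (metis u_def zero_neq_one)
  have "fun_space.dim {w. \<forall>i\<ge>e. w i = 0} = card (u ` {..<e})"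
  proof (rule fun_space.basis_card_eq_dim[symmetric])
    show "u ` {..<e} \<subseteq> {w. \<forall>i\<ge>e. w i = 0}" by (auto simp: u_def)
    show "{w. \<forall>i\<ge>e. w i = 0} \<subseteq> fun_space.span (u ` {..<e})"
    proof
      fix w :: "nat \<Rightarrow> gf5" assume w: "w \<in> {w. \<forall>i\<ge>e. w i = 0}"
      have "w = (\<lambda>j. \<Sum>i<e. w i * u i j)"
      proof
        fix j
        have "(\<Sum>i<e. w i * u i j) = (\<Sum>i<e. if i = j then w j else 0)"
          by (intro sum.cong) (auto simp: u_def)
        then show "w j = (\<Sum>i<e. w i * u i j)" using w by simp
      qed
      also have "\<dots> \<in> fun_space.span (u ` {..<e})"
        by (intro span_sum_fun span_times fun_space.span_base) auto
      finally show "w \<in> fun_space.span (u ` {..<e})" .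
    qed
    show "fun_space.independent (u ` {..<e})"
    proof
      assume "fun_space.dependent (u ` {..<e})"
      then obtain i where i: "u i \<in> fun_space.span (u ` {..<e} - {u i})"
        by (auto simp: fun_space.dependent_def)
      have "w i = 0" if "w \<in> fun_space.span (u ` {..<e} - {u i})" for w
        using that
      proof (induction rule: fun_space.span_induct_alt)
        case (step c x y)
        then have "x i = 0" by (auto simp: u_def)
        with step.IH show ?case by (simp add: plus_fun_def scale_fun_apply)
      qed (simp add: zero_fun_def)
      from this[OF i] show False by (simp add: u_def)
    qed
  qed
  also have "\<dots> = e" using card_image[OF inj_on_subset[OF u_inj]] by simp
  finally show ?thesis by (simp add: scale_word_eq_scale_fun)
qed

locale code_construction =
  fixes a b e f d k :: nat and ps :: "nat \<Rightarrow> nat \<Rightarrow> nat"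
  assumes ea: "e \<le> a" and fb: "f + d + k \<le> b"
begin

abbreviation "h \<equiv> code_hom a b e f d k ps"
abbreviation "G \<equiv> mixed_group (e + f) d"
abbreviation "C \<equiv> h ` carrier G"

lemma code_hom_fst: "i < a \<Longrightarrow> fst (h g) i = (if i < e then fst g i else 0)"
  by (simp add: code_hom_def case_prod_unfold)

lemma code_hom_snd:
  "j < b \<Longrightarrow> snd (h g) j = (if j < f then 5 * fst g (e + j)
       else if j < f + d then snd g (j - f)
       else if j < f + d + k then (\<Sum>t<d. int (ps (j - (f + d)) t) * snd g t) mod 25
       else 0)"
  by (simp add: code_hom_def case_prod_unfold)

lemma code_hom_in_carrier:
  assumes "g \<in> carrier G"
  shows "h g \<in> carrier (mixed_group a b)"
proof -
  have "fst (h g) \<in> PiE {..<a} (\<lambda>_. {0..<5})"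
  proof (rule PiE_I)
    fix i assume "i \<in> {..<a}"
    then show "fst (h g) i \<in> {0..<5}"
      using mixed_group_memD(1,2)[OF assms, of i] by (auto simp: code_hom_fst)
  qed (simp add: code_hom_def case_prod_unfold)
  moreover have "snd (h g) \<in> PiE {..<b} (\<lambda>_. {0..<25})"
  proof (rule PiE_I)
    fix j assume "j \<in> {..<b}"
    then show "snd (h g) j \<in> {0..<25}"
      using mixed_group_memD(1,2)[OF assms, of "e + j"] mixed_group_memD(3,4)[OF assms, of "j - f"]
      by (auto simp: code_hom_snd)
  qed (simp add: code_hom_def case_prod_unfold)
  ultimately show ?thesis by (simp add: carrier_mixed_group mem_Times_iff)
qed

lemma code_hom_hom: "h \<in> hom G (mixed_group a b)"
proof (rule homI)
  fix g g' assume g: "g \<in> carrier G" "g' \<in> carrier G"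
  have fst_mult: "fst (g \<otimes>\<^bsub>G\<^esub> g') i = (fst g i + fst g' i) mod 5" if "i < e + f" for i
    using that by (simp add: mult_mixed_group)
  have snd_mult: "snd (g \<otimes>\<^bsub>G\<^esub> g') t = (snd g t + snd g' t) mod 25" if "t < d" for t
    using that by (simp add: mult_mixed_group)
  have sum_mod: "(\<Sum>t<d. int (p t) * snd (g \<otimes>\<^bsub>G\<^esub> g') t) mod 25 =
      ((\<Sum>t<d. int (p t) * snd g t) mod 25 + (\<Sum>t<d. int (p t) * snd g' t) mod 25) mod 25" for p
  proof -
    have "(\<Sum>t<d. int (p t) * snd (g \<otimes>\<^bsub>G\<^esub> g') t) mod 25
        = (\<Sum>t<d. int (p t) * ((snd g t + snd g' t) mod 25)) mod 25"
      by (simp add: snd_mult)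
    also have "\<dots> = (\<Sum>t<d. int (p t) * ((snd g t + snd g' t) mod 25) mod 25) mod 25"
      by (simp only: mod_sum_eq)
    also have "\<dots> = (\<Sum>t<d. int (p t) * (snd g t + snd g' t) mod 25) mod 25"
      by (simp only: mod_mult_right_eq)
    also have "\<dots> = (\<Sum>t<d. int (p t) * (snd g t + snd g' t)) mod 25"
      by (simp only: mod_sum_eq)
    also have "\<dots> = ((\<Sum>t<d. int (p t) * snd g t) + (\<Sum>t<d. int (p t) * snd g' t)) mod 25"
      by (simp add: distrib_left sum.distrib)
    finally show ?thesis by (simp only: mod_add_eq)
  qed
  \<comment> \<open>Multiplication by 5 is a homomorphism from \<int>/5 to \<int>/25.\<close>
  have five: "5 * ((u + v) mod 5) = (5 * u + 5 * v) mod 25" for u v :: int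
    using mult_mod_right[of 5 "u + v" 5] by (simp add: distrib_left)
  have gg: "g \<otimes>\<^bsub>G\<^esub> g' \<in> carrier G"
    using g group_mixed_group[of "e + f" d] by (simp add: group.is_monoid monoid.m_closed)
  have hh: "h g \<otimes>\<^bsub>mixed_group a b\<^esub> h g' \<in> carrier (mixed_group a b)"
    using code_hom_in_carrier[OF g(1)] code_hom_in_carrier[OF g(2)] group_mixed_group[of a b]
    by (simp add: group.is_monoid monoid.m_closed)
  show "h (g \<otimes>\<^bsub>G\<^esub> g') = h g \<otimes>\<^bsub>mixed_group a b\<^esub> h g'"
  proof (rule mixed_group_eqI[OF code_hom_in_carrier[OF gg] hh])
    fix i assume i: "i < a"
    then have "fst (h g \<otimes>\<^bsub>mixed_group a b\<^esub> h g') i = (fst (h g) i + fst (h g') i) mod 5"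
      by (simp add: mult_mixed_group)
    with i show "fst (h (g \<otimes>\<^bsub>G\<^esub> g')) i = fst (h g \<otimes>\<^bsub>mixed_group a b\<^esub> h g') i"
      by (simp add: code_hom_fst fst_mult)
  next
    fix j assume j: "j < b"
    then have "snd (h g \<otimes>\<^bsub>mixed_group a b\<^esub> h g') j = (snd (h g) j + snd (h g') j) mod 25"
      by (simp add: mult_mixed_group)
    moreover have "snd (h (g \<otimes>\<^bsub>G\<^esub> g')) j = (snd (h g) j + snd (h g') j) mod 25"
    proof -
      consider "j < f" | "f \<le> j" "j < f + d" | "f + d \<le> j" "j < f + d + k" | "f + d + k \<le> j"
        by linarith
      then show ?thesis
      proof cases
        case 1
        then have "fst (g \<otimes>\<^bsub>G\<^esub> g') (e + j) = (fst g (e + j) + fst g' (e + j)) mod 5"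
          by (intro fst_mult) simp
        with 1 j show ?thesis by (simp only: code_hom_snd five if_True)
      next
        case 2
        then have "snd (g \<otimes>\<^bsub>G\<^esub> g') (j - f) = (snd g (j - f) + snd g' (j - f)) mod 25"
          by (intro snd_mult) linarith
        with 2 j show ?thesis by (simp add: code_hom_snd)
      next
        case 3
        with j show ?thesis
          using sum_mod[of "ps (j - (f + d))"] by (simp add: code_hom_snd)
      next
        case 4
        with j show ?thesis by (simp add: code_hom_snd)
      qed
    qed
    ultimately show "snd (h (g \<otimes>\<^bsub>G\<^esub> g')) j = snd (h g \<otimes>\<^bsub>mixed_group a b\<^esub> h g') j" by simp
  qed
qed (use code_hom_in_carrier in auto)

lemma code_hom_inj: "inj_on h (carrier G)"
proof (rule inj_onI)
  fix g g' assume g: "g \<in> carrier G" "g' \<in> carrier G" and eq: "h g = h g'"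
  show "g = g'"
  proof (rule mixed_group_eqI[OF g])
    fix i assume i: "i < e + f"
    show "fst g i = fst g' i"
    proof (cases "i < e")
      case True
      have "fst (h g) i = fst (h g') i" by (simp only: eq)
      with True ea show ?thesis by (simp add: code_hom_fst)
    next
      case False
      then obtain j where j: "i = e + j" by (metis le_Suc_ex not_less)
      have "snd (h g) j = snd (h g') j" by (simp only: eq)
      with i fb show ?thesis by (simp add: code_hom_snd j)
    qed
  next
    fix t assume "t < d"
    moreover have "snd (h g) (f + t) = snd (h g') (f + t)" by (simp only: eq)
    ultimately show "snd g t = snd g' t" using fb by (simp add: code_hom_snd)
  qed
qed

lemma code_subgroup: "subgroup C (mixed_group a b)"
  by (rule group_hom.img_is_subgroup)
    (simp add: group_hom_def group_hom_axioms_def group_mixed_group code_hom_hom)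

lemma code_iso: "(mixed_group a b)\<lparr>carrier := C\<rparr> \<cong> G"
proof (rule group.iso_sym[OF group_mixed_group])
  have "h \<in> iso G ((mixed_group a b)\<lparr>carrier := C\<rparr>)"
    using code_hom_hom code_hom_inj by (auto simp: iso_def hom_def bij_betw_def)
  then show "G \<cong> (mixed_group a b)\<lparr>carrier := C\<rparr>" by (auto simp: is_iso_def)
qed

text \<open>Only the first \<open>e\<close> generators reach the \<int>/5 coordinates; with all
  order 25 coefficients zero they already give every value there.\<close>

lemma code_first_coords: "first_coords a ` order5_subcode a b C = {w. \<forall>i\<ge>e. w i = 0}"
proof
  show "first_coords a ` order5_subcode a b C \<subseteq> {w. \<forall>i\<ge>e. w i = 0}"
    by (auto simp: order5_subcode_def first_coords_def case_prod_unfold code_hom_fst)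
  show "{w. \<forall>i\<ge>e. w i = 0} \<subseteq> first_coords a ` order5_subcode a b C"
  proof
    fix w :: "nat \<Rightarrow> gf5" assume w: "w \<in> {w. \<forall>i\<ge>e. w i = 0}"
    define g where "g = decode (e + f) d (\<lambda>i. if i < 2 * d then 0 else w (i - 2 * d))"
    have g: "g \<in> carrier G" unfolding g_def by (rule decode_in_carrier)
    have fst_g: "fst g i = lift5 (w i)" if "i < e + f" for i
      using that by (simp add: g_def fst_decode)
    have snd_g: "snd g t = 0" if "t < d" for t
      using that by (simp add: g_def snd_decode)
    have "(5 * snd (h g) j) mod 25 = 0" if "j < b" for j
      using that w by (auto simp: code_hom_snd fst_g snd_g)
    then have "h g [^]\<^bsub>mixed_group a b\<^esub> (5::nat) = \<one>\<^bsub>mixed_group a b\<^esub>"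
      by (subst mixed_group_pow[OF code_hom_in_carrier[OF g]]) (auto simp: one_mixed_group fun_eq_iff)
    with g have "h g \<in> order5_subcode a b C" by (simp add: order5_subcode_def)
    moreover have "w = first_coords a (h g)"
      using w ea by (auto simp: first_coords_def case_prod_unfold code_hom_fst fst_g fun_eq_iff)
    ultimately show "w \<in> first_coords a ` order5_subcode a b C" by blast
  qed
qed

lemma code_of_type: "additive_code_of_type a b (e + f) d e C"
  unfolding additive_code_of_type_def
  using code_subgroup code_iso dim_supported_words code_first_coords by simp

text \<open>The \<int>/25 coordinates from \<open>f + d + k\<close> on vanish, so the support bound
  gives \<open>e + d + (f + d + k)\<close>.\<close>

lemma code_rank_le: "rank (Gray Y a b ` C) \<le> e + f + 2 * d + k"
proof -
  have "rank (Gray Y a b ` C) \<le> word_space.dim (first_coords a ` order5_subcode a b C) + d + card {..<f + d + k}"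
    by (rule rank_le_support[OF code_hom_hom]) (use fb in \<open>auto simp: code_hom_snd\<close>)
  then show ?thesis by (simp add: code_first_coords dim_supported_words)
qed

text \<open>By transposition, \<open>rank\<close> many functions span all coordinate functions of
  the code. Every element of \<open>X\<close> is recovered from these coordinates.\<close>

lemma code_rank_ge:
  assumes Y: "Y 0 \<noteq> Y 1"
    and X: "X = var_funs (2 * d + (e + f)) \<union> (\<lambda>i. quot_form d (ps i)) ` {..<k}"
    and ind: "fun_space.independent X"
  shows "card X \<le> rank (Gray Y a b ` C)"
proof -
  define F where "F z = Gray Y a b (h (decode (e + f) d z))" for z
  have V: "Gray Y a b ` C = range F"
    by (simp add: F_def Gray_image_eq_range[OF code_hom_hom])
  have "finite (Gray Y a b ` C)" by (simp add: carrier_mixed_group finite_PiE)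
  then obtain B where B: "finite B" "range F \<subseteq> fun_space.span B"
    "card B = rank (Gray Y a b ` C)"
    using word_space.basis_exists[of "Gray Y a b ` C"] unfolding rank_def word_space.dim_span V
    by (metis finite_subset scale_word_eq_scale_fun)
  obtain M where M: "finite M" "card M \<le> card B" "\<And>i. (\<lambda>z. F z i) \<in> fun_space.span M"
    using column_span_of_row_span[of F B] B(1,2) by blast
  have digits: "(\<lambda>z. of_int (snd (h (decode (e + f) d z)) j)) \<in> fun_space.span M"
    "(\<lambda>z. of_int (snd (h (decode (e + f) d z)) j div 5)) \<in> fun_space.span M" if "j < b" for j
  proof -
    let ?y = "\<lambda>z. snd (h (decode (e + f) d z)) j"
    have col: "(a + 5 * j + i - a) div 5 = j" "(a + 5 * j + i - a) mod 5 = i"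
      "a + 5 * j + i < a + 5 * b" "\<not> a + 5 * j + i < a" if "i < 5" for i
      using that \<open>j < b\<close> by auto
    have F: "F z (a + 5 * j + i) = of_int (?y z div 5) + of_int (?y z) * Y i" if "i < 5" for i z
      using col[OF that]
      by (simp add: F_def Gray_def case_prod_unfold gray_def del: add_diff_cancel_left' diff_add_inverse)
    \<comment> \<open>Two entries of a block differ by a nonzero multiple of the low digit; removing
      the low digit from one entry leaves the high digit.\<close>
    have "F z (a + 5 * j + 1) - F z (a + 5 * j + 0) = (Y 1 - Y 0) * of_int (?y z)" for z
      by (subst (1 2) F) (simp_all add: algebra_simps)
    then have "(\<lambda>z. of_int (?y z)) = (\<lambda>z. inverse (Y 1 - Y 0) * (F z (a + 5 * j + 1) - F z (a + 5 * j + 0)))"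
      using Y by (simp only: mult.assoc[symmetric]) simp
    also have "\<dots> \<in> fun_space.span M" by (intro span_times span_minus M)
    finally show low: "(\<lambda>z. of_int (?y z)) \<in> fun_space.span M" .
    have "(\<lambda>z. of_int (?y z div 5)) = (\<lambda>z. F z (a + 5 * j + 0) - Y 0 * of_int (?y z))"
      by (subst F) (simp_all add: mult.commute)
    also have "\<dots> \<in> fun_space.span M" by (intro span_times span_minus M low)
    finally show "(\<lambda>z. of_int (?y z div 5)) \<in> fun_space.span M" .
  qed
  have low_var: "(\<lambda>z. z t) \<in> fun_space.span M" if "t < d" for t
    using digits(1)[of "f + t"] that fb by (simp add: code_hom_snd snd_decode)
  have high_var: "(\<lambda>z. z (d + t)) \<in> fun_space.span M" if "t < d" for t
    using digits(2)[of "f + t"] that fb by (simp add: code_hom_snd snd_decode)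
  have x_var: "(\<lambda>z. z (2 * d + i)) \<in> fun_space.span M" if "i < e + f" for i
  proof (cases "i < e")
    case True
    with ea have "F z i = z (2 * d + i)" for z
      by (simp add: F_def Gray_def case_prod_unfold code_hom_fst fst_decode)
    with M(3)[of i] show ?thesis by simp
  next
    \<comment> \<open>These generators enter as \<open>5 * x\<close>, so their value is the high
      digit of a \<int>/25 coordinate.\<close>
    case False
    then obtain j where j: "i = e + j" by (metis le_Suc_ex not_less)
    with that fb digits(2)[of j] show ?thesis by (simp add: code_hom_snd fst_decode)
  qed
  have var: "(\<lambda>z. z i) \<in> fun_space.span M" if "i < 2 * d + (e + f)" for i
  proof -
    consider "i < d" | "d \<le> i" "i < 2 * d" | "2 * d \<le> i" by linarith
    then show ?thesis
      using low_var[of i] high_var[of "i - d"] x_var[of "i - 2 * d"] that by cases auto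
  qed
  \<comment> \<open>The high digit of an additional column is the quotient plus a linear form
    \<open>?B\<close> in the high digits, which is already available and is subtracted.\<close>
  have quot: "quot_form d (ps s) \<in> fun_space.span M" if "s < k" for s
  proof -
    let ?B = "\<lambda>z. \<Sum>t<d. int (ps s t) * lift5 (z (d + t))"
    let ?S = "\<lambda>z. \<Sum>t<d. int (ps s t) * lift5 (z t)"
    have "snd (h (decode (e + f) d z)) (f + d + s) = (?S z + 5 * ?B z) mod 25" for z
      using that fb
      by (simp add: code_hom_snd snd_decode distrib_left sum.distrib sum_distrib_left mult_ac)
    moreover have "(u + 5 * v) mod 25 div 5 = (u div 5 + v) mod 5" for u v :: int
    proof -
      have "n mod 25 div 5 = n div 5 mod 5" for n :: int
        using zmod_zmult2_eq[of 5 n 5] by simp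
      then show ?thesis by (simp only: div_mult_self2) (simp only: add.commute)
    qed
    ultimately have "(\<lambda>z. of_int (?S z div 5) + of_int (?B z)) \<in> fun_space.span M"
      using digits(2)[of "f + d + s"] that fb by simp
    moreover have "(\<lambda>z. of_int (?B z)) \<in> fun_space.span M"
    proof -
      have "(\<lambda>z. of_int (?B z) :: gf5) = (\<lambda>z. \<Sum>t<d. of_nat (ps s t) * z (d + t))" by simp
      also have "\<dots> \<in> fun_space.span M" by (intro span_sum_fun span_times high_var) simp
      finally show ?thesis .
    qed
    ultimately have "(\<lambda>z. (of_int (?S z div 5) + of_int (?B z)) - of_int (?B z)) \<in> fun_space.span M"
      by (rule span_minus)
    then show ?thesis by (simp add: quot_form_def)
  qed
  have "X \<subseteq> fun_space.span M" using var quot by (auto simp: X var_funs_def)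
  with fun_space.independent_span_bound[OF M(1) ind] M(2) B(3) show ?thesis by linarith
qed

end

section \<open>The set of attainable ranks\<close>

theorem theorem7:
  fixes \<alpha> \<beta> \<gamma> \<delta> \<kappa> r :: nat and Y :: "nat \<Rightarrow> gf5"
  assumes "bij_betw Y {..<5} UNIV"
    and "0 < \<alpha>" and "0 < \<beta>" and "0 < \<gamma>" and "0 < \<delta>" and "0 < \<kappa>"
    and "0 < \<delta> + \<gamma>" and "\<delta> + \<gamma> \<le> \<beta> + \<kappa>" and "\<kappa> \<le> min \<alpha> \<gamma>"
  shows "(\<exists>C. linear_code_of_type Y \<alpha> \<beta> \<gamma> \<delta> \<kappa> C \<and> rank C = r) \<longleftrightarrow>
    r \<in> {\<gamma> + 2 * \<delta> .. min (\<beta> + \<delta> + \<kappa>)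
      (\<gamma> + \<delta> + ((\<delta> + 2) choose 3) + ((\<delta> + 3) choose 4) + ((\<delta> + 4) choose 5))}"
proof
  have Y: "Y 0 \<noteq> Y 1"
    using assms(1) inj_onD[of Y "{..<5}" 0 1] by (auto simp: bij_betw_def)
  {
    assume "\<exists>C. linear_code_of_type Y \<alpha> \<beta> \<gamma> \<delta> \<kappa> C \<and> rank C = r"
    then obtain C where C: "additive_code_of_type \<alpha> \<beta> \<gamma> \<delta> \<kappa> C" and r: "rank (Gray Y \<alpha> \<beta> ` C) = r"
      by (auto simp: linear_code_of_type_def)
    let ?A = "(mixed_group \<alpha> \<beta>)\<lparr>carrier := C\<rparr>"
    have sub: "subgroup C (mixed_group \<alpha> \<beta>)" and iso: "?A \<cong> mixed_group \<gamma> \<delta>"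
      and dim: "word_space.dim (first_coords \<alpha> ` order5_subcode \<alpha> \<beta> C) = \<kappa>"
      using C by (auto simp: additive_code_of_type_def)
    \<comment> \<open>The reversed isomorphism parametrizes the code by the standard group, as the
      rank bounds require.\<close>
    have "mixed_group \<gamma> \<delta> \<cong> ?A"
      using group.iso_sym[OF subgroup.subgroup_is_group[OF sub group_mixed_group] iso] .
    then obtain h where "h \<in> iso (mixed_group \<gamma> \<delta>) ?A" by (auto simp: is_iso_def)
    then have hom_A: "h \<in> hom (mixed_group \<gamma> \<delta>) ?A" and bij: "bij_betw h (carrier (mixed_group \<gamma> \<delta>)) C"
      by (auto simp: iso_def)
    have CH: "C \<subseteq> carrier (mixed_group \<alpha> \<beta>)" by (rule subgroup.subset[OF sub])
    with hom_A have hom: "h \<in> hom (mixed_group \<gamma> \<delta>) (mixed_group \<alpha> \<beta>)"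
      by (auto simp: hom_def)
    have img: "h ` carrier (mixed_group \<gamma> \<delta>) = C" using bij by (simp add: bij_betw_def)
    have "\<gamma> + 2 * \<delta> \<le> r"
      using rank_ge[OF Y CH] bij_betw_same_card[OF bij] r by (simp add: card_mixed_group)
    moreover have "r \<le> \<beta> + \<delta> + \<kappa>"
      using rank_le_support[OF hom, of "{..<\<beta>}" Y] r dim by (simp add: img)
    moreover have "r \<le> \<gamma> + \<delta> + ((\<delta> + 2) choose 3) + ((\<delta> + 3) choose 4) + ((\<delta> + 4) choose 5)"
      using rank_le_basis_funs[OF hom, of Y] card_basis_funs_le[OF assms(5), of \<gamma>] r
      by (simp add: img)
    ultimately show "r \<in> {\<gamma> + 2 * \<delta> .. min (\<beta> + \<delta> + \<kappa>)
      (\<gamma> + \<delta> + ((\<delta> + 2) choose 3) + ((\<delta> + 3) choose 4) + ((\<delta> + 4) choose 5))}" by simp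
  }
  {
    assume r: "r \<in> {\<gamma> + 2 * \<delta> .. min (\<beta> + \<delta> + \<kappa>)
      (\<gamma> + \<delta> + ((\<delta> + 2) choose 3) + ((\<delta> + 3) choose 4) + ((\<delta> + 4) choose 5))}"
    \<comment> \<open>\<open>k\<close> is the excess over the least rank, to be produced by
      \<open>k\<close> additional columns; \<open>f\<close> counts the order 5 generators placed in
      \<int>/25 coordinates.\<close>
    define k where "k = r - (\<gamma> + 2 * \<delta>)"
    define f where "f = \<gamma> - \<kappa>"
    have \<gamma>: "\<kappa> + f = \<gamma>" using assms(9) by (simp add: f_def)
    have rk: "r = \<kappa> + f + 2 * \<delta> + k" using r \<gamma> by (simp add: k_def)
    have "k + \<delta> \<le> ((\<delta> + 2) choose 3) + ((\<delta> + 3) choose 4) + ((\<delta> + 4) choose 5)"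
      using r \<gamma> rk by simp
    then obtain ps where ps: "fun_space.independent (var_funs (2 * \<delta> + (\<kappa> + f)) \<union> (\<lambda>i. quot_form \<delta> (ps i)) ` {..<k})"
      "card (var_funs (2 * \<delta> + (\<kappa> + f)) \<union> (\<lambda>i. quot_form \<delta> (ps i)) ` {..<k}) = 2 * \<delta> + (\<kappa> + f) + k"
      using independent_var_quot_forms[OF assms(5)] by blast
    \<comment> \<open>The columns fit because
      \<open>f + \<delta> + k = r - \<kappa> - \<delta>\<close>, which is at most
      \<open>\<beta>\<close>.\<close>
    interpret code_construction \<alpha> \<beta> \<kappa> f \<delta> k ps
      by standard (use assms(9) r \<gamma> rk in auto)
    have "rank (Gray Y \<alpha> \<beta> ` C) = r"
      using code_rank_le[of Y] code_rank_ge[OF Y refl ps(1)] by (simp only: ps(2) rk)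
    moreover have "linear_code_of_type Y \<alpha> \<beta> \<gamma> \<delta> \<kappa> (Gray Y \<alpha> \<beta> ` C)"
      using code_of_type unfolding linear_code_of_type_def \<gamma> by blast
    ultimately show "\<exists>C. linear_code_of_type Y \<alpha> \<beta> \<gamma> \<delta> \<kappa> C \<and> rank C = r" by blast
  }
qed

end
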